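(* For a system of $N$ queues with arbitrary switchover times and i.i.d. channels with ON probabilities $p_i$, $i\in\{1,\dots,N\}$, the stability region $\mathbf{\Lambda}$ is given by $$\mathbf{\Lambda}=\Big\{\boldsymbol\lambda\ge\mathbf{0}\ :\ \sum_{i=1}^N\frac{\lambda_i}{p_i}\le 1\Big\}.$$ In addition, the simple Exhaustive (Gated) policy is throughput-optimal.
   Context: Time is slotted, $t\in\{0,1,2,\dots\}$, with slot length equal to one packet transmission time. There are $N>1$ parallel queues and one server. The number $A_i(t)$ of packets arriving to queue $i$ in slot $t$ is an i.i.d. process over $t$ with mean $\lambda_i$ and $\mathbb{E}[A_i^2(t)]\le A_{\max}^2$. The channel states $C_i(t)\in\{0,1\}$ ($1$ = ON, $0$ = OFF) are i.i.d. over $t$ (memoryless channels) with $\mathbb{P}(C_i(t)=1)=p_i>0$; the $p_i$ may differ across queues. All arrival and channel processes are independent. The queue lengths $Q_i(t)$ and the channel states $C_i(t)$ of all queues are known to the server at the beginning of each slot. Based on this information the server dynamically decides either to stay with its current queue or to switch to another queue; switching from queue $i$ to queue $j$ takes a finite constant number $D_{ij}$ of slots, during which no packet is served. One packet is received from queue $i$ in slot $t$ (if the queue is nonempty) if the server is at queue $i$, decides to stay at queue $i$, and $C_i(t)=1$. The system is stable if $\limsup_{t\to\infty}\frac1t\sum_{\tau=0}^{t-1}\sum_{i=1}^N\mathbb{E}[Q_i(\tau)]<\infty$. The stability region $\mathbf{\Lambda}$ is the set of all arrival rate vectors $\boldsymbol\lambda=(\lambda_1,\dots,\lambda_N)$ such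 that there exists a control algorithm that stabilizes the system. A policy is said to achieve a $\gamma$-fraction of $\mathbf{\Lambda}$ if it stabilizes the system for all input rates inside $\gamma\mathbf{\Lambda}$; a policy is throughput-optimal if this holds with $\gamma=1$. Gated policy: the server visits the queues in cyclic order; in each visit to a queue it stays until it has served exactly the packets that were present in that queue when the server arrived there, and then switches to the next queue. (The Exhaustive policy instead stays until the queue is empty.)
   Formalization: Λ is described up to its boundary: its closure is the stated set, its interior relative to λ≥0 is the set with Σλ_i/p_i<1, and rates "inside" Λ are those in this interior. Equality fails, e.g. for Bernoulli arrivals with Σλ_i/p_i=1. Switchover times are at least one slot. *)

theory Defs
  imports "HOL-Probability.Probability"
begin

text \<open>
  The queues are indexed by a finite type \<open>'n\<close>, so that \<open>N = CARD('n)\<close>.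

  The exogenous randomness consists of the arrivals \<open>A i t\<close>, the channel states \<open>C i t\<close>
  (\<open>True\<close> is ON), and a random seed that the control algorithm may use to randomise its decisions.
\<close>

record ('w, 'n) inputs =
  law :: "'w measure"
  arrivals :: "'n \<Rightarrow> nat \<Rightarrow> 'w \<Rightarrow> nat"
  channels :: "'n \<Rightarrow> nat \<Rightarrow> 'w \<Rightarrow> bool"
  seed :: "'w \<Rightarrow> real"

datatype 'n source = Arrival 'n nat | Channel 'n nat | Seed

fun source_value :: "('w, 'n) inputs \<Rightarrow> 'n source \<Rightarrow> 'w \<Rightarrow> real" where
  "source_value S (Arrival i t) \<omega> = real (arrivals S i t \<omega>)"
| "source_value S (Channel i t) \<omega> = of_bool (channels S i t \<omega>)"
| "source_value S Seed \<omega> = seed S \<omega>"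

definition valid_inputs :: "('n::finite \<Rightarrow> real) \<Rightarrow> real ^ 'n \<Rightarrow> ('w, 'n) inputs \<Rightarrow> bool" where
  "valid_inputs p r S \<longleftrightarrow>
     prob_space (law S) \<and>
     prob_space.indep_vars (law S) (\<lambda>_. borel) (source_value S) UNIV \<and>
     (\<forall>i t. distr (law S) (count_space UNIV) (arrivals S i t)
              = distr (law S) (count_space UNIV) (arrivals S i 0)) \<and>
     (\<forall>i t. (\<integral>\<omega>. real (arrivals S i t \<omega>) \<partial>law S) = r $ i) \<and>
     (\<exists>amax::real. \<forall>i t.
        (\<integral>\<^sup>+\<omega>. ennreal ((real (arrivals S i t \<omega>))\<^sup>2) \<partial>law S) \<le> ennreal (amax\<^sup>2)) \<and>
     (\<forall>i t. measure (law S) {\<omega> \<in> space (law S). channels S i t \<omega>} = p i) \<and>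
     distr (law S) borel (seed S) = uniform_measure lborel {0..1}"

text \<open>
  What the server sees at the beginning of a slot.  If \<open>delay\<close> is 0 the server is present at
  queue \<open>loc\<close>; otherwise it is on its way to \<open>loc\<close>, and this slot and the following
  \<open>delay - 1\<close> slots are still spent on switching.
\<close>

datatype 'n obs = Obs (qlen: "'n \<Rightarrow> nat") (chan: "'n \<Rightarrow> bool") (loc: 'n) (delay: nat)

text \<open>
  A control algorithm maps the seed and the observations of all slots up to the current one
  (most recent first) to the queue at which it wants the server: the current queue (stay)
  or another one (switch).  The decision is ignored while the server is switching.
\<close>

type_synonym 'n policy = "real \<Rightarrow> 'n obs list \<Rightarrow> 'n"

definition admissible :: "'n policy \<Rightarrow> bool" where
  "admissible \<pi> \<longleftrightarrow> (\<forall>h. (\<lambda>u. \<pi> u h) \<in> borel \<rightarrow>\<^sub>M count_space UNIV)"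

text \<open>
  Given an observation, the decision \<open>j\<close> and the arrivals \<open>a\<close> of the slot, the queue lengths
  and the server status at the beginning of the next slot.  A decision to switch in slot \<open>t\<close>
  uses up the slots \<open>t, ..., t + D i j - 1\<close>.
\<close>

definition served :: "'n obs \<Rightarrow> 'n \<Rightarrow> 'n \<Rightarrow> nat" where
  "served x j i =
     of_bool (delay x = 0 \<and> loc x = i \<and> j = i \<and> chan x i \<and> 0 < qlen x i)"

definition next_qlen :: "'n obs \<Rightarrow> 'n \<Rightarrow> ('n \<Rightarrow> nat) \<Rightarrow> 'n \<Rightarrow> nat" where
  "next_qlen x j a = (\<lambda>i. qlen x i - served x j i + a i)"

definition next_loc :: "'n obs \<Rightarrow> 'n \<Rightarrow> 'n" where
  "next_loc x j = (if delay x = 0 then j else loc x)"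

definition next_delay :: "('n \<Rightarrow> 'n \<Rightarrow> nat) \<Rightarrow> 'n obs \<Rightarrow> 'n \<Rightarrow> nat" where
  "next_delay D x j =
     (if delay x = 0 then (if j = loc x then 0 else D (loc x) j - 1) else delay x - 1)"

text \<open>The observations of slots \<open>t, ..., 0\<close>, started with the server at \<open>s\<^sub>0\<close> and queues \<open>q\<^sub>0\<close>.\<close>

primrec history ::
  "('n \<Rightarrow> 'n \<Rightarrow> nat) \<Rightarrow> 'n \<Rightarrow> ('n \<Rightarrow> nat) \<Rightarrow> ('w, 'n) inputs \<Rightarrow> 'n policy \<Rightarrow> 'w \<Rightarrow> nat \<Rightarrow> 'n obs list"
where
  "history D s\<^sub>0 q\<^sub>0 S \<pi> \<omega> 0 = [Obs q\<^sub>0 (\<lambda>i. channels S i 0 \<omega>) s\<^sub>0 0]"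
| "history D s\<^sub>0 q\<^sub>0 S \<pi> \<omega> (Suc t) =
     (let h = history D s\<^sub>0 q\<^sub>0 S \<pi> \<omega> t; x = hd h; j = \<pi> (seed S \<omega>) h
      in Obs (next_qlen x j (\<lambda>i. arrivals S i t \<omega>)) (\<lambda>i. channels S i (Suc t) \<omega>)
             (next_loc x j) (next_delay D x j) # h)"

definition queue_length ::
  "('n \<Rightarrow> 'n \<Rightarrow> nat) \<Rightarrow> 'n \<Rightarrow> ('n \<Rightarrow> nat) \<Rightarrow> ('w, 'n) inputs \<Rightarrow> 'n policy \<Rightarrow> 'n \<Rightarrow> nat \<Rightarrow> 'w \<Rightarrow> nat"
where
  "queue_length D s\<^sub>0 q\<^sub>0 S \<pi> i t \<omega> = qlen (hd (history D s\<^sub>0 q\<^sub>0 S \<pi> \<omega> t)) i"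

definition stable ::
  "('n::finite \<Rightarrow> 'n \<Rightarrow> nat) \<Rightarrow> 'n \<Rightarrow> ('n \<Rightarrow> nat) \<Rightarrow> ('w, 'n) inputs \<Rightarrow> 'n policy \<Rightarrow> bool"
where
  "stable D s\<^sub>0 q\<^sub>0 S \<pi> \<longleftrightarrow>
     limsup (\<lambda>t. (\<Sum>\<tau><t. \<Sum>i\<in>UNIV. \<integral>\<^sup>+\<omega>. of_nat (queue_length D s\<^sub>0 q\<^sub>0 S \<pi> i \<tau> \<omega>) \<partial>law S)
                 / of_nat t) < (\<infinity>::ennreal)"

text \<open>
  Below, \<open>S r\<close> are the inputs that the system is fed with when the vector of arrival rates is
  \<open>r\<close>; the rates do not determine the distribution of the arrivals.
\<close>

definition stability_region ::
  "('n::finite \<Rightarrow> 'n \<Rightarrow> nat) \<Rightarrow> 'n \<Rightarrow> ('n \<Rightarrow> nat) \<Rightarrow> (real ^ 'n \<Rightarrow> ('w, 'n) inputs) \<Rightarrow> (real ^ 'n) set"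
where
  "stability_region D s\<^sub>0 q\<^sub>0 S =
     {r. (\<forall>i. 0 \<le> r $ i) \<and> (\<exists>\<pi>. admissible \<pi> \<and> stable D s\<^sub>0 q\<^sub>0 (S r) \<pi>)}"

text \<open>
  ``Inside'' is meant relative to the nonnegative orthant: rates \<open>r $ i = 0\<close> are not excluded.
\<close>

definition rates_inside :: "(real ^ 'n::finite) set \<Rightarrow> (real ^ 'n) set" where
  "rates_inside R = (top_of_set {r. \<forall>i. 0 \<le> r $ i}) interior_of R"

definition achieves_fraction ::
  "real \<Rightarrow> ('n::finite \<Rightarrow> 'n \<Rightarrow> nat) \<Rightarrow> 'n \<Rightarrow> ('n \<Rightarrow> nat) \<Rightarrow> (real ^ 'n \<Rightarrow> ('w, 'n) inputs)
     \<Rightarrow> 'n policy \<Rightarrow> bool"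
where
  "achieves_fraction \<gamma> D s\<^sub>0 q\<^sub>0 S \<pi> \<longleftrightarrow>
     admissible \<pi> \<and>
     (\<forall>r \<in> rates_inside ((\<lambda>x. \<gamma> *\<^sub>R x) ` stability_region D s\<^sub>0 q\<^sub>0 S). stable D s\<^sub>0 q\<^sub>0 (S r) \<pi>)"

definition throughput_optimal ::
  "('n::finite \<Rightarrow> 'n \<Rightarrow> nat) \<Rightarrow> 'n \<Rightarrow> ('n \<Rightarrow> nat) \<Rightarrow> (real ^ 'n \<Rightarrow> ('w, 'n) inputs) \<Rightarrow> 'n policy \<Rightarrow> bool"
where
  "throughput_optimal = achieves_fraction 1"

text \<open>The successor map of a cyclic order on the queues: a single orbit.\<close>

definition cyclic_order :: "('n::finite \<Rightarrow> 'n) \<Rightarrow> bool" where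
  "cyclic_order nx \<longleftrightarrow> (\<forall>i j. \<exists>k. (nx ^^ k) i = j)"

definition exhaustive_policy :: "('n \<Rightarrow> 'n) \<Rightarrow> 'n policy" where
  "exhaustive_policy nx = (\<lambda>_ h.
     let x = hd h; i = loc x in if 0 < qlen x i then i else nx i)"

text \<open>
  The slots of the current visit to queue \<open>i\<close> form the longest initial segment of the history in
  which the server is present at \<open>i\<close>; the last of them is the slot of its arrival there.  In all
  slots of the visit but the current one the server has decided to stay.
\<close>

definition gated_policy :: "('n \<Rightarrow> 'n) \<Rightarrow> 'n policy" where
  "gated_policy nx = (\<lambda>_ h.
     let i = loc (hd h);
         visit = takeWhile (\<lambda>x. loc x = i \<and> delay x = 0) h;
         present = qlen (last visit) i;
         done = (\<Sum>x\<leftarrow>tl visit. served x i i)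
     in if done < present then i else nx i)"

end

theory Submission
  imports Defs
begin

text \<open>
  The system is governed by its work \<open>w(t) = \<Sum>i. Q\<^sub>i(t) / p\<^sub>i\<close>: a packet of queue \<open>i\<close> takes
  \<open>1 / p\<^sub>i\<close> slots of service on average, so \<open>w(t)\<close> is the mean time needed to serve all
  packets without any switching.  Per slot it grows by the load
  \<open>\<rho> = \<Sum>i. \<lambda>\<^sub>i / p\<^sub>i\<close> on average.

  Upper bound on the region.  Whether the server is at queue \<open>i\<close> at the beginning of a slot is
  determined before the channel states of that slot, hence independent of them.  So whatever the
  control algorithm does with the channel states, service removes work at a mean rate of at most
  \<open>\<Sum>i. (1 / p\<^sub>i) p\<^sub>i P(server at i) \<le> 1\<close>.  If \<open>\<rho> > 1\<close>, the mean work therefore grows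
  linearly and its time averages diverge (\<open>stable_imp_load_le_1\<close>).

  Stability below full load.  The Exhaustive and the Gated policy are treated together, as policies
  that walk through the cyclic order, stay only at nonempty queues, and leave a queue only when the
  packets found on arrival there have been served.  For such a policy there is a constant \<open>K\<close> with
  the following property on every sample path (\<open>mostly_stays\<close>): if at least \<open>n\<close> packets are
  present in slot \<open>t\<close>, then all but \<open>K\<close> of the next \<open>n\<close> slots are spent staying at a nonempty
  queue.  Indeed, a larger number of switching slots would contain a full round of visits that
  began after \<open>t\<close>; all these packets would have been served by the end of the round, which takes at
  least \<open>n\<close> slots of service and leaves none for switching.  As \<open>K\<close> does not depend
  on \<open>n\<close>, one can fix an \<open>n\<close> with \<open>n (1 - \<rho>) \<ge> K + 1\<close>; then the work drifts down over \<open>n\<close>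
  slots whenever it is large.  With bounded second moments of the arrivals this becomes

    \<open>E (w(t + n)\<^sup>2) + 2 E (w(t)) \<le> E (w(t)\<^sup>2) + C\<close>    (\<open>square_drift\<close>),

  and summing over all slots \<open>t < T\<close> (not only over multiples of \<open>n\<close>) telescopes to a linear bound
  on \<open>\<Sum>t<T. E (w(t))\<close>, which is stability.

  Both halves use independence in one form only: a random variable determined by some of the sources
  is uncorrelated with any other source (\<open>expectation_mult_source\<close>).  In the second half it is
  applied to \<open>w(t)\<close> times the indicator of staying in a slot \<open>u \<ge> t\<close>, and this is where it
  matters that the two policies do not look at the current channel states.

  The stability region thus lies between the simplices \<open>\<rho> < 1\<close> and \<open>\<rho> \<le> 1\<close> of the nonnegative
  orthant, which determines its closure and its relative interior.
\<close>

section \<open>Cyclic clearing policies along a sample path\<close>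

text \<open>
  A sample path as an abstract sequence \<open>x\<close> of observations, \<open>j\<close> of decisions and \<open>a\<close> of arrivals.
  What the Exhaustive and the Gated policy have in common is expressed through a quota \<open>todo\<close> of
  packets that are still to be served in the current visit: it covers at least the packets found on
  arrival, decreases by no more than the packets served, and has to be exhausted before the server
  leaves.  For the Exhaustive policy it is the current queue length, for the Gated policy the number
  of gated packets not yet served.
\<close>

locale cyclic_clearing_path =
  fixes D :: "'n::finite \<Rightarrow> 'n \<Rightarrow> nat" and nx :: "'n \<Rightarrow> 'n"
    and x :: "nat \<Rightarrow> 'n obs" and j :: "nat \<Rightarrow> 'n" and a :: "nat \<Rightarrow> 'n \<Rightarrow> nat"
    and todo :: "nat \<Rightarrow> nat"
  assumes delay_0: "delay (x 0) = 0"
    and qlen_Suc: "qlen (x (Suc t)) = next_qlen (x t) (j t) (a t)"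
    and loc_Suc: "loc (x (Suc t)) = next_loc (x t) (j t)"
    and delay_Suc: "delay (x (Suc t)) = next_delay D (x t) (j t)"
    and decision: "delay (x t) = 0 \<Longrightarrow>
      j t = loc (x t) \<and> 0 < qlen (x t) (loc (x t)) \<or> j t = nx (loc (x t)) \<and> todo t = 0"
    and todo_arrive: "delay (x (Suc t)) = 0 \<Longrightarrow> \<not> (delay (x t) = 0 \<and> j t = loc (x t)) \<Longrightarrow>
      qlen (x (Suc t)) (loc (x (Suc t))) \<le> todo (Suc t)"
    and todo_stay: "delay (x t) = 0 \<Longrightarrow> j t = loc (x t) \<Longrightarrow>
      todo t \<le> todo (Suc t) + served (x t) (j t) (loc (x t))"
begin

definition stays :: "nat \<Rightarrow> bool" where
  "stays t \<longleftrightarrow> delay (x t) = 0 \<and> j t = loc (x t)"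

definition departures :: "nat \<Rightarrow> nat \<Rightarrow> nat" where
  "departures t n = (\<Sum>u<n. of_bool (delay (x (t + u)) = 0 \<and> j (t + u) \<noteq> loc (x (t + u))))"

definition services :: "nat \<Rightarrow> nat \<Rightarrow> 'n \<Rightarrow> nat" where
  "services t n i = (\<Sum>u<n. served (x (t + u)) (j (t + u)) i)"

lemma departures_0 [simp]: "departures t 0 = 0"
  and departures_Suc: "departures t (Suc n) = departures t n
    + of_bool (delay (x (t + n)) = 0 \<and> j (t + n) \<noteq> loc (x (t + n)))"
  by (simp_all add: departures_def)

lemma services_0 [simp]: "services t 0 i = 0"
  and services_Suc: "services t (Suc n) i = services t n i + served (x (t + n)) (j (t + n)) i"
  by (simp_all add: services_def)

lemma D_le_sum: "D i k \<le> (\<Sum>i\<in>UNIV. \<Sum>k\<in>UNIV. D i k)"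
proof -
  have "D i k \<le> (\<Sum>k\<in>UNIV. D i k)" by (rule member_le_sum) auto
  also have "\<dots> \<le> (\<Sum>i\<in>UNIV. \<Sum>k\<in>UNIV. D i k)"
    by (rule member_le_sum[where f = "\<lambda>i. \<Sum>k\<in>UNIV. D i k"]) auto
  finally show ?thesis .
qed

lemma delay_le: "delay (x t) \<le> (\<Sum>i\<in>UNIV. \<Sum>k\<in>UNIV. D i k)"
proof (induction t)
  case (Suc t)
  then show ?case
    using D_le_sum[of "loc (x t)" "j t"] by (auto simp: delay_Suc next_delay_def)
qed (simp add: delay_0)

text \<open>
  Each departure costs a bounded number of switching slots, and so does the trip that may be under way
  in slot \<open>t\<close>.  Counting the remaining delay in advance makes the bound inductive.
\<close>

lemma non_stays_le:
  "(\<Sum>u<n. of_bool (\<not> stays (t + u))) + delay (x (t + n))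
     \<le> Suc (\<Sum>i\<in>UNIV. \<Sum>k\<in>UNIV. D i k) * Suc (departures t n)"
proof (induction n)
  case 0
  then show ?case using delay_le[of t] by (simp add: departures_Suc)
next
  case (Suc n)
  then show ?case
    using D_le_sum[of "loc (x (t + n))" "j (t + n)"]
    by (auto simp: delay_Suc next_delay_def stays_def departures_Suc simp del: sum_of_bool_eq)
qed

lemma loc_departures: "loc (x (t + n)) = (nx ^^ departures t n) (loc (x t))"
proof (induction n)
  case (Suc n)
  then show ?case using decision[of "t + n"]
    by (auto simp: loc_Suc next_loc_def departures_Suc)
qed (simp add: departures_Suc)

lemma qlen_services: "qlen (x t) i \<le> qlen (x (t + n)) i + services t n i"
proof (induction n)
  case (Suc n)
  then show ?case by (auto simp: qlen_Suc next_qlen_def services_Suc)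
qed (simp add: services_Suc)

text \<open>
  The first departure after slot \<open>t\<close> ends a visit that may have begun before \<open>t\<close>, whose quota says
  nothing about the packets present at \<open>t\<close>.  After that departure every visit begins after \<open>t\<close>, when
  the packets of slot \<open>t\<close> have either been served or are found by the server.
\<close>

lemma todo_covers:
  assumes "0 < departures t n" "delay (x (t + n)) = 0"
  shows "qlen (x t) (loc (x (t + n))) \<le> todo (t + n) + services t n (loc (x (t + n)))"
  using assms
proof (induction n)
  case (Suc n)
  show ?case
  proof (cases "stays (t + n)")
    case True
    then have s: "delay (x (t + n)) = 0" "j (t + n) = loc (x (t + n))"
      by (auto simp: stays_def)
    then have "0 < departures t n" using Suc.prems by (simp add: departures_Suc)
    with Suc.IH s have
      "qlen (x t) (loc (x (t + n))) \<le> todo (t + n) + services t n (loc (x (t + n)))"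
      by simp
    then show ?thesis
      using todo_stay[OF s] s by (simp add: services_Suc loc_Suc next_loc_def)
  next
    case False
    then have "qlen (x (Suc (t + n))) (loc (x (Suc (t + n)))) \<le> todo (Suc (t + n))"
      using todo_arrive[of "t + n"] Suc.prems by (auto simp: stays_def)
    then show ?thesis
      using qlen_services[of t "loc (x (t + Suc n))" "Suc n"] by simp
  qed
qed (simp add: departures_Suc)

text \<open>
  The quota is exhausted at the departure, and by then it covers the unserved packets of slot \<open>t\<close>.
\<close>

lemma cleared:
  assumes "0 < k" "k < departures t n"
  shows "qlen (x t) ((nx ^^ k) (loc (x t))) \<le> services t n ((nx ^^ k) (loc (x t)))"
  using assms
proof (induction n)
  case (Suc n)
  show ?case
  proof (cases "k < departures t n")
    case True
    with Suc show ?thesis by (simp add: services_Suc)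
  next
    case False
    then have d: "delay (x (t + n)) = 0" "j (t + n) \<noteq> loc (x (t + n))"
      and k: "k = departures t n"
      using Suc.prems
      by (cases "delay (x (t + n)) = 0 \<and> j (t + n) \<noteq> loc (x (t + n))"; simp add: departures_Suc)+
    have "todo (t + n) = 0" using decision[of "t + n"] d by auto
    then have "qlen (x t) ((nx ^^ k) (loc (x t))) \<le> services t n ((nx ^^ k) (loc (x t)))"
      using todo_covers[of t n] Suc.prems d by (simp add: loc_departures k)
    then show ?thesis by (simp add: services_Suc)
  qed
qed (simp add: departures_Suc)

lemma sum_services_le: "(\<Sum>i\<in>UNIV. services t n i) \<le> (\<Sum>u<n. of_bool (stays (t + u)))"
proof -
  have "(\<Sum>i\<in>UNIV. services t n i) = (\<Sum>u<n. \<Sum>i\<in>UNIV. served (x (t + u)) (j (t + u)) i)"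
    unfolding services_def by (rule sum.swap)
  also have "\<dots> \<le> (\<Sum>u<n. of_bool (stays (t + u)))"
  proof (rule sum_mono)
    fix u
    have "(\<Sum>i\<in>UNIV. served (x (t + u)) (j (t + u)) i)
        \<le> (\<Sum>i\<in>UNIV. if i = loc (x (t + u)) then of_bool (stays (t + u)) else 0)"
      by (rule sum_mono) (auto simp: served_def stays_def)
    then show "(\<Sum>i\<in>UNIV. served (x (t + u)) (j (t + u)) i) \<le> of_bool (stays (t + u))"
      by simp
  qed
  finally show ?thesis .
qed

text \<open>
  A window with many switching slots contains a full round of visits that began after slot \<open>t\<close>.  When
  the round is over, at least \<open>n\<close> packets have been served, one per slot, which contradicts the
  switching slots in the window.
\<close>

lemma mostly_stays:
  assumes reach: "\<And>i k. \<exists>m<N. (nx ^^ m) i = k"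
    and backlog: "n \<le> (\<Sum>i\<in>UNIV. qlen (x t) i)"
  shows "n \<le> (\<Sum>u<n. of_bool (stays (t + u))) + Suc (\<Sum>i\<in>UNIV. \<Sum>k\<in>UNIV. D i k) * Suc N"
proof (rule ccontr)
  define K where "K = Suc (\<Sum>i\<in>UNIV. \<Sum>k\<in>UNIV. D i k)"
  have split: "(\<Sum>u<n. of_bool (stays (t + u))) + (\<Sum>u<n. of_bool (\<not> stays (t + u))) = n"
  proof -
    have "of_bool b + of_bool (\<not> b) = (1::nat)" for b by (cases b) simp_all
    then show ?thesis unfolding sum.distrib[symmetric] by simp
  qed
  assume "\<not> ?thesis"
  then have few: "(\<Sum>u<n. of_bool (stays (t + u))) + K * Suc N < n" by (simp add: K_def)
  \<comment> \<open>One departure more than a round has, as the first may end a visit begun before \<open>t\<close>.\<close>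
  then have "K * Suc N < K * Suc (departures t n)"
    using split non_stays_le[where n = n and t = t, folded K_def] by linarith
  then have dep: "N < departures t n" by simp
  have "qlen (x t) i \<le> services t n i" for i
  proof -
    obtain m where m: "m < N" "(nx ^^ m) (nx (loc (x t))) = i" using reach by blast
    have "(nx ^^ Suc m) (loc (x t)) = i" using m(2) by (simp only: funpow_Suc_right o_apply)
    then show ?thesis using cleared[of "Suc m" t n] m(1) dep by simp
  qed
  then have "n \<le> (\<Sum>u<n. of_bool (stays (t + u)))"
    using backlog sum_services_le[of t n] sum_mono[of UNIV "qlen (x t)" "services t n"] by simp
  then show False using few by simp
qed

end

lemma cyclic_order_bounded_reach:
  fixes nx :: "'n::finite \<Rightarrow> 'n"
  assumes "cyclic_order nx"
  obtains N where "\<And>i k. \<exists>m<N. (nx ^^ m) i = k"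
proof -
  obtain f where f: "\<And>i k. (nx ^^ f i k) i = k"
    using assms unfolding cyclic_order_def by metis
  have "\<exists>m < Suc (Max (range (\<lambda>(i, k). f i k))). (nx ^^ m) i = k" for i k
    using f[of i k] by (intro exI[of _ "f i k"]) (auto simp: less_Suc_eq_le intro!: Max_ge)
  then show ?thesis using that by blast
qed

lemma cyclic_order_no_fixpoint:
  fixes nx :: "'n::finite \<Rightarrow> 'n"
  assumes "cyclic_order nx" "1 < CARD('n)"
  shows "nx i \<noteq> i"
proof
  assume fixpoint: "nx i = i"
  have "(nx ^^ k) i = i" for k by (induction k) (simp_all add: fixpoint)
  then have "UNIV = {i}" using assms(1) unfolding cyclic_order_def by (metis UNIV_eq_I singletonI)
  then show False using assms(2) by (metis card.empty card.insert empty_iff finite.emptyI less_irrefl One_nat_def)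
qed

definition clearing_policy ::
  "('n::finite \<Rightarrow> 'n \<Rightarrow> nat) \<Rightarrow> ('n \<Rightarrow> 'n) \<Rightarrow> 'n \<Rightarrow> ('n \<Rightarrow> nat) \<Rightarrow> ('w, 'n) inputs \<Rightarrow> 'n policy \<Rightarrow> bool"
where
  "clearing_policy D nx s\<^sub>0 q\<^sub>0 S \<pi> \<longleftrightarrow> (\<forall>\<omega>. \<exists>todo.
     cyclic_clearing_path D nx (\<lambda>t. hd (history D s\<^sub>0 q\<^sub>0 S \<pi> \<omega> t))
       (\<lambda>t. \<pi> (seed S \<omega>) (history D s\<^sub>0 q\<^sub>0 S \<pi> \<omega> t)) (\<lambda>t i. arrivals S i t \<omega>) todo)"

lemma exhaustive_policy_clearing:
  "clearing_policy D nx s\<^sub>0 q\<^sub>0 S (exhaustive_policy nx)"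
  unfolding clearing_policy_def
proof
  fix \<omega>
  let ?x = "\<lambda>t. hd (history D s\<^sub>0 q\<^sub>0 S (exhaustive_policy nx) \<omega> t)"
  have "cyclic_clearing_path D nx ?x
    (\<lambda>t. exhaustive_policy nx (seed S \<omega>) (history D s\<^sub>0 q\<^sub>0 S (exhaustive_policy nx) \<omega> t))
    (\<lambda>t i. arrivals S i t \<omega>) (\<lambda>t. qlen (?x t) (loc (?x t)))"
    by unfold_locales
      (auto simp: Let_def exhaustive_policy_def next_qlen_def next_loc_def)
  then show "\<exists>todo. cyclic_clearing_path D nx ?x
    (\<lambda>t. exhaustive_policy nx (seed S \<omega>) (history D s\<^sub>0 q\<^sub>0 S (exhaustive_policy nx) \<omega> t))
    (\<lambda>t i. arrivals S i t \<omega>) todo" by blast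
qed

definition visit :: "'n obs list \<Rightarrow> 'n obs list" where
  "visit h = takeWhile (\<lambda>x. loc x = loc (hd h) \<and> delay x = 0) h"

definition gated_todo :: "'n obs list \<Rightarrow> nat" where
  "gated_todo h = qlen (last (visit h)) (loc (hd h))
     - (\<Sum>x\<leftarrow>tl (visit h). served x (loc (hd h)) (loc (hd h)))"

lemma gated_policy_eq:
  "gated_policy nx u h = (if 0 < gated_todo h then loc (hd h) else nx (loc (hd h)))"
  by (simp add: gated_policy_def gated_todo_def visit_def Let_def)

lemma gated_todo_stay:
  assumes "delay x = 0" "loc y = loc x" "delay y = 0"
  shows "gated_todo (y # x # h) = gated_todo (x # h) - served x (loc x) (loc x)"
  using assms by (simp add: gated_todo_def visit_def)

text \<open>
  The previous slot found the server elsewhere or on its way, so a visit starts now and everything in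
  the queue is gated.
\<close>

lemma gated_todo_arrive:
  assumes "delay y = 0" "\<not> (loc x = loc y \<and> delay x = 0)"
  shows "gated_todo (y # x # h) = qlen y (loc y)"
  using assms by (auto simp: gated_todo_def visit_def)

lemma gated_policy_clearing:
  fixes nx :: "'n::finite \<Rightarrow> 'n"
  shows "clearing_policy D nx s\<^sub>0 q\<^sub>0 S (gated_policy nx)"
  unfolding clearing_policy_def
proof
  fix \<omega>
  let ?h = "history D s\<^sub>0 q\<^sub>0 S (gated_policy nx) \<omega>"
  let ?x = "\<lambda>t. hd (?h t)"
  let ?j = "\<lambda>t. gated_policy nx (seed S \<omega>) (?h t)"
  let ?todo = "\<lambda>t. gated_todo (?h t)"
  have h_eq: "?h t = ?x t # tl (?h t)" for t by (cases t) (simp_all add: Let_def)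
  have h_Suc: "?h (Suc t) = ?x (Suc t) # ?x t # tl (?h t)" for t
    by (subst h_eq[of t, symmetric]) (simp add: Let_def)
  have q_Suc: "qlen (?x (Suc t)) = next_qlen (?x t) (?j t) (\<lambda>i. arrivals S i t \<omega>)"
    and l_Suc: "loc (?x (Suc t)) = next_loc (?x t) (?j t)"
    and d_Suc: "delay (?x (Suc t)) = next_delay D (?x t) (?j t)" for t
    by (simp_all add: Let_def)
  have arrive: "?todo (Suc t) = qlen (?x (Suc t)) (loc (?x (Suc t)))"
    if "delay (?x (Suc t)) = 0" "\<not> (delay (?x t) = 0 \<and> ?j t = loc (?x t))" for t
  proof -
    have "\<not> (loc (?x t) = loc (?x (Suc t)) \<and> delay (?x t) = 0)"
      using that(2) unfolding l_Suc next_loc_def by auto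
    from gated_todo_arrive[OF that(1) this, of "tl (?h t)"]
    show ?thesis by (rule trans[OF arg_cong[OF h_Suc, of gated_todo]])
  qed
  have stay: "?todo (Suc t) = ?todo t - served (?x t) (?j t) (loc (?x t))"
    if "delay (?x t) = 0" "?j t = loc (?x t)" for t
  proof -
    have "loc (?x (Suc t)) = loc (?x t)" "delay (?x (Suc t)) = 0"
      using that unfolding l_Suc d_Suc by (simp_all only: next_loc_def next_delay_def if_True refl)
    from gated_todo_stay[OF that(1) this, of "tl (?h t)", folded h_eq]
    have "gated_todo (?x (Suc t) # ?h t) = ?todo t - served (?x t) (?j t) (loc (?x t))"
      unfolding that(2) .
    with arg_cong[OF h_Suc, of gated_todo t, folded h_eq] show ?thesis by (rule trans)
  qed
  \<comment> \<open>The gated packets are still in the queue, so the policy stays only at nonempty queues.\<close>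
  have le: "delay (?x t) = 0 \<Longrightarrow> ?todo t \<le> qlen (?x t) (loc (?x t))" for t
  proof (induction t)
    case 0
    then show ?case by (simp add: gated_todo_def visit_def)
  next
    case (Suc t)
    show ?case
    proof (cases "delay (?x t) = 0 \<and> ?j t = loc (?x t)")
      case True
      then have s: "delay (?x t) = 0" "?j t = loc (?x t)" by blast+
      have l: "loc (?x (Suc t)) = loc (?x t)" using s unfolding l_Suc next_loc_def by simp
      have "?todo t - served (?x t) (?j t) (loc (?x t))
          \<le> qlen (?x t) (loc (?x t)) - served (?x t) (?j t) (loc (?x t)) + arrivals S (loc (?x t)) t \<omega>"
        using Suc.IH[OF s(1)] by linarith
      then show ?thesis
        unfolding stay[OF s] l q_Suc next_qlen_def .
    next
      case False
      from arrive[OF Suc.prems this] show ?thesis by (rule eq_refl)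
    qed
  qed
  have "cyclic_clearing_path D nx ?x ?j (\<lambda>t i. arrivals S i t \<omega>) ?todo"
  proof
    show "delay (?x 0) = 0" by simp
  next
    fix t assume d: "delay (?x t) = 0"
    then show "?j t = loc (?x t) \<and> 0 < qlen (?x t) (loc (?x t)) \<or> ?j t = nx (loc (?x t)) \<and> ?todo t = 0"
      using le[OF d] by (auto simp: gated_policy_eq)
  next
    fix t assume "delay (?x t) = 0" "?j t = loc (?x t)"
    from stay[OF this] show "?todo t \<le> ?todo (Suc t) + served (?x t) (?j t) (loc (?x t))" by linarith
  next
    fix t assume "delay (?x (Suc t)) = 0" "\<not> (delay (?x t) = 0 \<and> ?j t = loc (?x t))"
    from arrive[OF this] show "qlen (?x (Suc t)) (loc (?x (Suc t))) \<le> ?todo (Suc t)" by (rule eq_refl[OF sym])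
  qed (rule q_Suc l_Suc d_Suc)+
  then show "\<exists>todo. cyclic_clearing_path D nx ?x ?j (\<lambda>t i. arrivals S i t \<omega>) todo" by blast
qed

section \<open>Information and independence\<close>

instance obs :: (finite) countable
proof (rule countable_classI[of "\<lambda>x. to_nat (qlen x, chan x, loc x, delay x)"])
  fix x y :: "'a obs"
  show "x = y" if "to_nat (qlen x, chan x, loc x, delay x) = to_nat (qlen y, chan y, loc y, delay y)"
    using that by (auto intro: obs.expand)
qed

lemma measurable_pair_count_space:
  fixes f :: "'w \<Rightarrow> 'a::countable" and g :: "'w \<Rightarrow> 'b::countable"
  assumes "f \<in> M \<rightarrow>\<^sub>M count_space UNIV" "g \<in> M \<rightarrow>\<^sub>M count_space UNIV"
  shows "(\<lambda>x. (f x, g x)) \<in> M \<rightarrow>\<^sub>M count_space UNIV"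
  using measurable_Pair[OF assms] by (simp add: pair_measure_countable)

lemma measurable_fun_count_space:
  fixes f :: "'w \<Rightarrow> 'n::finite \<Rightarrow> 'b::countable"
  assumes [measurable]: "\<And>i. (\<lambda>\<omega>. f \<omega> i) \<in> M \<rightarrow>\<^sub>M count_space UNIV"
  shows "f \<in> M \<rightarrow>\<^sub>M count_space UNIV"
  unfolding measurable_count_space_eq2_countable
proof (intro conjI ballI)
  fix g :: "'n \<Rightarrow> 'b"
  have "f -` {g} \<inter> space M = {\<omega> \<in> space M. \<forall>i. f \<omega> i = g i}" by auto
  also have "\<dots> \<in> sets M" by measurable
  finally show "f -` {g} \<inter> space M \<in> sets M" .
qed simp

locale queueing_inputs =
  fixes p :: "'n::finite \<Rightarrow> real" and r :: "real ^ 'n" and I :: "('w, 'n) inputs"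
  assumes valid: "valid_inputs p r I"
    and p_pos: "\<And>i. 0 < p i"
begin

sublocale prob_space "law I"
  using valid by (simp add: valid_inputs_def)

lemma source_value_eq:
  "source_value I (Arrival i t) = (\<lambda>\<omega>. real (arrivals I i t \<omega>))"
  "source_value I (Channel i t) = (\<lambda>\<omega>. of_bool (channels I i t \<omega>))"
  "source_value I Seed = seed I"
  by (simp_all add: fun_eq_iff)

lemma indep_sources: "indep_vars (\<lambda>_. borel) (source_value I) UNIV"
  using valid by (simp add: valid_inputs_def)

lemma source_measurable [measurable]: "source_value I s \<in> borel_measurable (law I)"
  using indep_sources unfolding indep_vars_def by simp

definition info :: "'n source set \<Rightarrow> 'w measure" where
  "info J = vimage_algebra (space (law I)) (\<lambda>\<omega>. \<lambda>s\<in>J. source_value I s \<omega>) (PiM J (\<lambda>_. borel))"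

lemma space_info [simp]: "space (info J) = space (law I)"
  by (simp add: info_def)

lemma source_measurable_info:
  assumes "s \<in> J"
  shows "source_value I s \<in> borel_measurable (info J)"
proof -
  have "(\<lambda>\<omega>. \<lambda>s\<in>J. source_value I s \<omega>) \<in> info J \<rightarrow>\<^sub>M PiM J (\<lambda>_. borel)"
    unfolding info_def by (rule measurable_vimage_algebra1) (auto simp: space_PiM)
  from measurable_compose[OF this measurable_component_singleton[OF assms]] show ?thesis
    using assms by simp
qed

lemma measurable_from_info:
  assumes X: "X \<in> info J \<rightarrow>\<^sub>M N" and K: "space K = space (law I)"
    and J: "\<And>s. s \<in> J \<Longrightarrow> source_value I s \<in> borel_measurable K"
  shows "X \<in> K \<rightarrow>\<^sub>M N"
proof -
  have "(\<lambda>\<omega>. \<omega>) \<in> K \<rightarrow>\<^sub>M info J"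
    unfolding info_def
    by (rule measurable_vimage_algebra2) (auto simp: K intro!: measurable_restrict J)
  from measurable_compose[OF this X] show ?thesis .
qed

lemma info_mono: "X \<in> info J \<rightarrow>\<^sub>M N \<Longrightarrow> J \<subseteq> K \<Longrightarrow> X \<in> info K \<rightarrow>\<^sub>M N"
  by (rule measurable_from_info) (auto intro: source_measurable_info)

lemma info_measurable: "X \<in> info J \<rightarrow>\<^sub>M N \<Longrightarrow> X \<in> law I \<rightarrow>\<^sub>M N"
  by (rule measurable_from_info) auto

text \<open>
  Independence of all sources makes the whole family indexed by \<open>J\<close> independent of the source \<open>s\<close>; a
  variable that is measurable with respect to the family generates a smaller sigma-algebra.
\<close>

lemma indep_var_fresh_source:
  assumes X: "X \<in> borel_measurable (info J)" and s: "s \<notin> J"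
  shows "indep_var borel X borel (source_value I s)"
proof -
  let ?R = "\<lambda>J \<omega>. \<lambda>s\<in>J. source_value I s \<omega>"
  have R: "?R J \<in> space (law I) \<rightarrow> space (PiM J (\<lambda>_. borel))" for J
    by (auto simp: space_PiM)
  have "indep_var (PiM J (\<lambda>_. borel)) (?R J) (PiM {s} (\<lambda>_. borel)) (?R {s})"
    by (rule indep_var_restrict[OF indep_sources]) (use s in auto)
  then have ind: "indep_set
      (sigma_sets (space (law I)) {?R J -` A \<inter> space (law I) | A. A \<in> sets (PiM J (\<lambda>_. borel))})
      (sigma_sets (space (law I)) {?R {s} -` A \<inter> space (law I) | A. A \<in> sets (PiM {s} (\<lambda>_. borel))})"
    by (simp add: indep_var_eq)
  have sub: "sigma_sets (space (law I)) {Y -` A \<inter> space (law I) | A. A \<in> sets borel} \<subseteq>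
      sigma_sets (space (law I)) {?R K -` A \<inter> space (law I) | A. A \<in> sets (PiM K (\<lambda>_. borel))}"
    if "Y \<in> borel_measurable (info K)" for Y :: "'w \<Rightarrow> real" and K
  proof -
    have "Y -` A \<inter> space (law I) \<in> sets (info K)" if "A \<in> sets borel" for A
      using measurable_sets[OF \<open>Y \<in> _\<close> that] by simp
    then show ?thesis
      unfolding info_def sets_vimage_algebra by (intro sigma_sets_mono) auto
  qed
  have "indep_set (sigma_sets (space (law I)) {X -` A \<inter> space (law I) |A. A \<in> sets borel})
      (sigma_sets (space (law I)) {source_value I s -` A \<inter> space (law I) |A. A \<in> sets borel})"
    using ind unfolding indep_set_def
    by (rule indep_sets_mono_sets)
      (use sub[OF X] sub[OF source_measurable_info[of s "{s}"]] in \<open>auto split: bool.split\<close>)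
  then show ?thesis
    unfolding indep_var_eq using info_measurable[OF X] by auto
qed

lemma
  assumes X: "X \<in> borel_measurable (info J)" "s \<notin> J"
    and int: "integrable (law I) X" "integrable (law I) (source_value I s)"
  shows expectation_mult_source:
      "expectation (\<lambda>\<omega>. X \<omega> * source_value I s \<omega>) = expectation X * expectation (source_value I s)"
    and integrable_mult_source: "integrable (law I) (\<lambda>\<omega>. X \<omega> * source_value I s \<omega>)"
  using indep_var_lebesgue_integral[OF indep_var_fresh_source[OF X] int]
    indep_var_integrable[OF indep_var_fresh_source[OF X] int] by auto

lemma arrivals_measurable_info:
  assumes "Arrival i t \<in> J"
  shows "arrivals I i t \<in> info J \<rightarrow>\<^sub>M count_space UNIV"
proof -
  have "(\<lambda>\<omega>. nat \<lfloor>source_value I (Arrival i t) \<omega>\<rfloor>) \<in> info J \<rightarrow>\<^sub>M count_space UNIV"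
    using source_measurable_info[OF assms] by measurable
  then show ?thesis by simp
qed

lemma channels_measurable_info:
  assumes "Channel i t \<in> J"
  shows "channels I i t \<in> info J \<rightarrow>\<^sub>M count_space UNIV"
proof -
  have "Measurable.pred (info J) (\<lambda>\<omega>. source_value I (Channel i t) \<omega> = 1)"
    using source_measurable_info[OF assms] by measurable
  then show ?thesis by simp
qed

lemma arrivals_measurable [measurable]: "arrivals I i t \<in> law I \<rightarrow>\<^sub>M count_space UNIV"
  by (rule info_measurable[OF arrivals_measurable_info[of i t UNIV]]) simp

lemma channels_measurable [measurable]: "channels I i t \<in> law I \<rightarrow>\<^sub>M count_space UNIV"
  by (rule info_measurable[OF channels_measurable_info[of i t UNIV]]) simp

lemma integrable_channel: "integrable (law I) (source_value I (Channel i t))"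
  by (rule integrable_const_bound[of _ 1]) auto

lemma expectation_channel: "expectation (source_value I (Channel i t)) = p i"
proof -
  have "expectation (source_value I (Channel i t)) =
      expectation (indicator {\<omega> \<in> space (law I). channels I i t \<omega>})"
    by (intro Bochner_Integration.integral_cong) (auto simp: indicator_def)
  also have "\<dots> = prob {\<omega> \<in> space (law I). channels I i t \<omega>}"
    by (simp add: Int_absorb1)
  also have "\<dots> = p i" using valid by (simp add: valid_inputs_def)
  finally show ?thesis .
qed

lemma arrival_second_moment:
  obtains B where "\<And>i t. integrable (law I) (\<lambda>\<omega>. (real (arrivals I i t \<omega>))\<^sup>2)"
    "\<And>i t. expectation (\<lambda>\<omega>. (real (arrivals I i t \<omega>))\<^sup>2) \<le> B"
proof -
  obtain amax :: real where amax: "\<And>i t.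
      (\<integral>\<^sup>+\<omega>. ennreal ((real (arrivals I i t \<omega>))\<^sup>2) \<partial>law I) \<le> ennreal (amax\<^sup>2)"
    using valid unfolding valid_inputs_def by blast
  have int: "integrable (law I) (\<lambda>\<omega>. (real (arrivals I i t \<omega>))\<^sup>2)" for i t
    using amax[of i t] by (intro integrableI_bounded) (auto intro: le_less_trans)
  have "expectation (\<lambda>\<omega>. (real (arrivals I i t \<omega>))\<^sup>2) \<le> amax\<^sup>2" for i t
    using amax[of i t] nn_integral_eq_integral[OF int[of i t]] by simp
  with int show ?thesis by (rule that)
qed

lemma integrable_arrival_square: "integrable (law I) (\<lambda>\<omega>. (real (arrivals I i t \<omega>))\<^sup>2)"
  using arrival_second_moment by metis

lemma integrable_arrival: "integrable (law I) (source_value I (Arrival i t))"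
proof -
  have "integrable (law I) (\<lambda>\<omega>. real (arrivals I i t \<omega>))"
    by (rule square_integrable_imp_integrable[OF _ integrable_arrival_square]) measurable
  then show ?thesis by (simp add: source_value_eq)
qed

lemma expectation_arrival: "expectation (source_value I (Arrival i t)) = r $ i"
  using valid by (simp add: valid_inputs_def source_value_eq)

end

locale controlled_queues = queueing_inputs p r I
  for p :: "'n::finite \<Rightarrow> real" and r :: "real ^ 'n" and I :: "('w, 'n) inputs" +
  fixes D :: "'n \<Rightarrow> 'n \<Rightarrow> nat" and s\<^sub>0 :: 'n and q\<^sub>0 :: "'n \<Rightarrow> nat" and \<pi> :: "'n policy"
  assumes admissible: "admissible \<pi>"
begin

abbreviation hist :: "nat \<Rightarrow> 'w \<Rightarrow> 'n obs list" where
  "hist t \<omega> \<equiv> history D s\<^sub>0 q\<^sub>0 I \<pi> \<omega> t"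

definition obs :: "nat \<Rightarrow> 'w \<Rightarrow> 'n obs" where
  "obs t \<omega> = hd (hist t \<omega>)"

definition decision :: "nat \<Rightarrow> 'w \<Rightarrow> 'n" where
  "decision t \<omega> = \<pi> (seed I \<omega>) (hist t \<omega>)"

definition Q :: "'n \<Rightarrow> nat \<Rightarrow> 'w \<Rightarrow> nat" where
  "Q i t \<omega> = qlen (obs t \<omega>) i"

text \<open>
  The sources that determine queue lengths, location and delay at the beginning of slot \<open>t\<close>, and those
  that determine the observation of slot \<open>t\<close>, which also shows the current channel states.
\<close>

definition past :: "nat \<Rightarrow> 'n source set" where
  "past t = {Seed} \<union> {Arrival i s | i s. s < t} \<union> {Channel i s | i s. s < t}"

definition present :: "nat \<Rightarrow> 'n source set" where
  "present t = past t \<union> {Channel i t | i. True}"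

text \<open>
  Everything the server knows in slot \<open>t\<close> except the current channel states.  Separating them off keeps
  the channel states of the slot independent of the rest.
\<close>

definition before_channels :: "nat \<Rightarrow> 'w \<Rightarrow> ('n \<Rightarrow> nat) \<times> 'n \<times> nat \<times> 'n obs list" where
  "before_channels t \<omega> = (qlen (obs t \<omega>), loc (obs t \<omega>), delay (obs t \<omega>), tl (hist t \<omega>))"

lemma hist_Suc: "hist (Suc t) \<omega> = obs (Suc t) \<omega> # hist t \<omega>"
  by (simp add: obs_def Let_def)

lemma obs_Suc: "obs (Suc t) \<omega> =
    Obs (next_qlen (obs t \<omega>) (decision t \<omega>) (\<lambda>i. arrivals I i t \<omega>)) (\<lambda>i. channels I i (Suc t) \<omega>)
      (next_loc (obs t \<omega>) (decision t \<omega>)) (next_delay D (obs t \<omega>) (decision t \<omega>))"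
  by (simp add: obs_def decision_def Let_def)

lemma chan_obs: "chan (obs t \<omega>) = (\<lambda>i. channels I i t \<omega>)"
  by (cases t) (simp_all add: obs_def Let_def)

lemma hist_eq: "hist t \<omega> = obs t \<omega> # tl (hist t \<omega>)"
  by (cases t) (simp_all add: obs_def Let_def)

definition with_channels ::
  "('n \<Rightarrow> bool) \<Rightarrow> ('n \<Rightarrow> nat) \<times> 'n \<times> nat \<times> 'n obs list \<Rightarrow> 'n obs list" where
  "with_channels c = (\<lambda>(q, l, d, h). Obs q c l d # h)"

lemma hist_with_channels: "hist t \<omega> = with_channels (\<lambda>i. channels I i t \<omega>) (before_channels t \<omega>)"
  using hist_eq[where t = t and \<omega> = \<omega>] by (simp add: with_channels_def before_channels_def flip: chan_obs)

lemma policy_measurable_info: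
  assumes "Seed \<in> J" and h: "h \<in> info J \<rightarrow>\<^sub>M count_space UNIV"
  shows "(\<lambda>\<omega>. \<pi> (seed I \<omega>) (h \<omega>)) \<in> info J \<rightarrow>\<^sub>M count_space UNIV"
proof (rule measurable_compose_countable[OF _ h])
  fix l
  have "(\<lambda>u. \<pi> u l) \<in> borel \<rightarrow>\<^sub>M count_space UNIV" using admissible by (simp add: admissible_def)
  from measurable_compose[OF source_measurable_info[OF assms(1)] this]
  show "(\<lambda>\<omega>. \<pi> (seed I \<omega>) l) \<in> info J \<rightarrow>\<^sub>M count_space UNIV" by simp
qed

lemma present_subset: "present t \<subseteq> past (Suc t)"
  by (auto simp: present_def past_def)

lemma past_mono: "s \<le> t \<Longrightarrow> past s \<subseteq> past t"
  by (auto simp: past_def)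

lemma hist_measurable_present:
  assumes "before_channels t \<in> info (past t) \<rightarrow>\<^sub>M count_space UNIV"
  shows "hist t \<in> info (present t) \<rightarrow>\<^sub>M count_space UNIV"
proof -
  have pre: "before_channels t \<in> info (present t) \<rightarrow>\<^sub>M count_space UNIV"
    using assms by (rule info_mono) (auto simp: present_def)
  have c: "(\<lambda>\<omega> i. channels I i t \<omega>) \<in> info (present t) \<rightarrow>\<^sub>M count_space UNIV"
    by (intro measurable_fun_count_space channels_measurable_info) (auto simp: present_def)
  have "(\<lambda>\<omega>. case (\<lambda>i. channels I i t \<omega>, before_channels t \<omega>) of (c, b) \<Rightarrow> with_channels c b)
      \<in> info (present t) \<rightarrow>\<^sub>M count_space UNIV"
    by (rule measurable_compose[OF measurable_pair_count_space[OF c pre]]) simp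
  then show ?thesis by (simp flip: hist_with_channels)
qed

text \<open>
  Histories take countably many values because there are finitely many queues, so only the dependence
  on the seed requires an assumption of measurability on the policy.
\<close>

lemma before_channels_measurable: "before_channels t \<in> info (past t) \<rightarrow>\<^sub>M count_space UNIV"
proof (induction t)
  case 0
  have "before_channels 0 = (\<lambda>\<omega>. (q\<^sub>0, s\<^sub>0, 0, []))"
    by (auto simp: before_channels_def obs_def)
  then show ?case by simp
next
  case (Suc t)
  let ?J = "past (Suc t)"
  have h: "hist t \<in> info ?J \<rightarrow>\<^sub>M count_space UNIV"
    by (rule info_mono[OF hist_measurable_present[OF Suc.IH] present_subset])
  have d: "decision t \<in> info ?J \<rightarrow>\<^sub>M count_space UNIV"
    unfolding decision_def by (rule policy_measurable_info[OF _ h]) (simp add: past_def)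
  have a: "(\<lambda>\<omega> i. arrivals I i t \<omega>) \<in> info ?J \<rightarrow>\<^sub>M count_space UNIV"
    by (intro measurable_fun_count_space arrivals_measurable_info) (auto simp: past_def)
  have "(\<lambda>\<omega>. case (hist t \<omega>, decision t \<omega>, \<lambda>i. arrivals I i t \<omega>) of
        (h, j, a) \<Rightarrow> (next_qlen (hd h) j a, next_loc (hd h) j, next_delay D (hd h) j, h))
      \<in> info ?J \<rightarrow>\<^sub>M count_space UNIV"
    by (rule measurable_compose[OF measurable_pair_count_space[OF h measurable_pair_count_space[OF d a]]])
      simp
  also have "(\<lambda>\<omega>. case (hist t \<omega>, decision t \<omega>, \<lambda>i. arrivals I i t \<omega>) of
        (h, j, a) \<Rightarrow> (next_qlen (hd h) j a, next_loc (hd h) j, next_delay D (hd h) j, h))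
      = before_channels (Suc t)"
    by (rule ext) (simp only: before_channels_def hist_Suc obs_Suc obs.sel list.sel prod.case obs_def[symmetric])
  finally show ?case .
qed

lemma decision_measurable: "decision t \<in> info (present t) \<rightarrow>\<^sub>M count_space UNIV"
  unfolding decision_def
  by (rule policy_measurable_info[OF _ hist_measurable_present[OF before_channels_measurable]])
    (simp add: present_def past_def)

lemma state_measurable_past:
  shows "Q i t \<in> info (past t) \<rightarrow>\<^sub>M count_space UNIV"
  and "(\<lambda>\<omega>. loc (obs t \<omega>)) \<in> info (past t) \<rightarrow>\<^sub>M count_space UNIV"
  and "(\<lambda>\<omega>. delay (obs t \<omega>)) \<in> info (past t) \<rightarrow>\<^sub>M count_space UNIV"
  using measurable_compose[OF before_channels_measurable[of t], of "\<lambda>(q, l, d, h). q i" "count_space UNIV"]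
    measurable_compose[OF before_channels_measurable[of t], of "\<lambda>(q, l, d, h). l" "count_space UNIV"]
    measurable_compose[OF before_channels_measurable[of t], of "\<lambda>(q, l, d, h). d" "count_space UNIV"]
  by (simp_all add: before_channels_def Q_def[abs_def])

end

section \<open>The expected work\<close>

context queueing_inputs
begin

lemma r_nonneg: "0 \<le> r $ i"
  using Bochner_Integration.integral_nonneg[of "law I" "source_value I (Arrival i 0)"]
  by (simp add: expectation_arrival)

definition load :: real where
  "load = (\<Sum>i\<in>UNIV. r $ i / p i)"

definition inflow :: "nat \<Rightarrow> 'w \<Rightarrow> real" where
  "inflow t \<omega> = (\<Sum>i\<in>UNIV. real (arrivals I i t \<omega>) / p i)"

lemma load_nonneg: "0 \<le> load"
  unfolding load_def by (intro sum_nonneg divide_nonneg_pos r_nonneg p_pos)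

lemma inflow_nonneg: "0 \<le> inflow t \<omega>"
  unfolding inflow_def by (intro sum_nonneg divide_nonneg_pos p_pos) simp

lemma inflow_measurable [measurable]: "inflow t \<in> borel_measurable (law I)"
  unfolding inflow_def by measurable

text \<open>
  The bound is uniform in \<open>t\<close>, which makes the constant in the drift inequality uniform.
\<close>

lemma inflow_second_moment:
  obtains B where "\<And>t. integrable (law I) (\<lambda>\<omega>. (inflow t \<omega>)\<^sup>2)"
    "\<And>t. expectation (\<lambda>\<omega>. (inflow t \<omega>)\<^sup>2) \<le> B"
proof -
  obtain B where int: "\<And>i t. integrable (law I) (\<lambda>\<omega>. (real (arrivals I i t \<omega>))\<^sup>2)"
    and B: "\<And>i t. expectation (\<lambda>\<omega>. (real (arrivals I i t \<omega>))\<^sup>2) \<le> B"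
    using arrival_second_moment by metis
  let ?f = "\<lambda>t \<omega>. (\<Sum>i\<in>UNIV. (real (arrivals I i t \<omega>))\<^sup>2 / (p i)\<^sup>2) * CARD('n)"
  have le: "(inflow t \<omega>)\<^sup>2 \<le> ?f t \<omega>" for t \<omega>
    using sum_squared_le_sum_of_squares[of "\<lambda>i. real (arrivals I i t \<omega>) / p i" UNIV]
    by (simp add: inflow_def power_divide)
  have f: "integrable (law I) (?f t)" for t
    by (intro Bochner_Integration.integrable_sum integrable_mult_left integrable_divide int)
  have sq: "integrable (law I) (\<lambda>\<omega>. (inflow t \<omega>)\<^sup>2)" for t
    by (rule Bochner_Integration.integrable_bound[OF f[of t]])
      (use order_trans[OF le abs_ge_self] in simp_all)
  have "expectation (\<lambda>\<omega>. (inflow t \<omega>)\<^sup>2) \<le> (\<Sum>i\<in>UNIV. B / (p i)\<^sup>2) * CARD('n)" for t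
  proof -
    have "expectation (\<lambda>\<omega>. (inflow t \<omega>)\<^sup>2) \<le> expectation (?f t)"
      by (intro integral_mono sq f le)
    also have "\<dots> = (\<Sum>i\<in>UNIV. expectation (\<lambda>\<omega>. (real (arrivals I i t \<omega>))\<^sup>2) / (p i)\<^sup>2) * CARD('n)"
      by (simp add: Bochner_Integration.integral_sum integrable_divide int)
    also have "\<dots> \<le> (\<Sum>i\<in>UNIV. B / (p i)\<^sup>2) * CARD('n)"
      by (intro mult_right_mono sum_mono divide_right_mono B) auto
    finally show ?thesis .
  qed
  with sq show ?thesis by (rule that)
qed

end

context controlled_queues
begin

definition serv :: "'n \<Rightarrow> nat \<Rightarrow> 'w \<Rightarrow> nat" where
  "serv i t \<omega> = served (obs t \<omega>) (decision t \<omega>) i"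

definition work :: "nat \<Rightarrow> 'w \<Rightarrow> real" where
  "work t \<omega> = (\<Sum>i\<in>UNIV. real (Q i t \<omega>) / p i)"

definition outflow :: "nat \<Rightarrow> 'w \<Rightarrow> real" where
  "outflow t \<omega> = (\<Sum>i\<in>UNIV. real (serv i t \<omega>) / p i)"

lemma serv_eq: "serv i t \<omega> = of_bool (delay (obs t \<omega>) = 0 \<and> loc (obs t \<omega>) = i
    \<and> decision t \<omega> = i \<and> channels I i t \<omega> \<and> 0 < Q i t \<omega>)"
  by (simp add: serv_def served_def chan_obs Q_def)

lemma Q_Suc: "real (Q i (Suc t) \<omega>) = real (Q i t \<omega>) - real (serv i t \<omega>) + real (arrivals I i t \<omega>)"
proof -
  have "serv i t \<omega> \<le> Q i t \<omega>" by (simp add: serv_eq)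
  moreover have "Q i (Suc t) \<omega> = Q i t \<omega> - serv i t \<omega> + arrivals I i t \<omega>"
    by (simp add: Q_def obs_Suc next_qlen_def serv_def)
  ultimately show ?thesis by simp
qed

lemma work_Suc: "work (Suc t) \<omega> = work t \<omega> + (inflow t \<omega> - outflow t \<omega>)"
  unfolding work_def inflow_def outflow_def sum_subtractf[symmetric] sum.distrib[symmetric]
  by (intro sum.cong refl) (simp add: Q_Suc add_divide_distrib diff_divide_distrib)

lemma work_add: "work (t + n) \<omega> = work t \<omega> + (\<Sum>u<n. inflow (t + u) \<omega> - outflow (t + u) \<omega>)"
  by (induction n) (simp_all add: work_Suc)

lemma work_nonneg: "0 \<le> work t \<omega>"
  unfolding work_def by (intro sum_nonneg divide_nonneg_pos p_pos) simp

lemma outflow_nonneg: "0 \<le> outflow t \<omega>"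
  unfolding outflow_def by (intro sum_nonneg divide_nonneg_pos p_pos) simp

lemma outflow_le: "outflow t \<omega> \<le> (\<Sum>i\<in>UNIV. 1 / p i)"
  unfolding outflow_def
  by (intro sum_mono divide_right_mono) (auto simp: serv_eq p_pos less_imp_le)

lemma decision_measurable_law [measurable]: "decision t \<in> law I \<rightarrow>\<^sub>M count_space UNIV"
  by (rule info_measurable[OF decision_measurable])

lemma state_measurable_law [measurable]:
  "Q i t \<in> law I \<rightarrow>\<^sub>M count_space UNIV"
  "(\<lambda>\<omega>. loc (obs t \<omega>)) \<in> law I \<rightarrow>\<^sub>M count_space UNIV"
  "(\<lambda>\<omega>. delay (obs t \<omega>)) \<in> law I \<rightarrow>\<^sub>M count_space UNIV"
  by (rule state_measurable_past[THEN info_measurable])+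

lemma serv_measurable [measurable]: "serv i t \<in> law I \<rightarrow>\<^sub>M count_space UNIV"
proof -
  have "serv i t = (\<lambda>\<omega>. case (delay (obs t \<omega>), loc (obs t \<omega>), decision t \<omega>, channels I i t \<omega>, Q i t \<omega>)
      of (d, l, j, c, q) \<Rightarrow> of_bool (d = 0 \<and> l = i \<and> j = i \<and> c \<and> 0 < q))"
    by (simp add: serv_eq fun_eq_iff)
  also have "\<dots> \<in> law I \<rightarrow>\<^sub>M count_space UNIV"
    by (rule measurable_compose[where N = "count_space UNIV"])
      (intro measurable_pair_count_space state_measurable_law decision_measurable_law
        channels_measurable, simp)
  finally show ?thesis .
qed

lemma outflow_measurable [measurable]: "outflow t \<in> borel_measurable (law I)"
  unfolding outflow_def by measurable

lemma work_measurable_past: "work t \<in> borel_measurable (info (past t))"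
proof -
  have [measurable]: "Q i t \<in> info (past t) \<rightarrow>\<^sub>M count_space UNIV" for i
    by (rule state_measurable_past)
  show ?thesis unfolding work_def by measurable
qed

lemma work_measurable [measurable]: "work t \<in> borel_measurable (law I)"
  by (rule info_measurable[OF work_measurable_past])

lemma integrable_work_square: "integrable (law I) (\<lambda>\<omega>. (work t \<omega>)\<^sup>2)"
proof (induction t)
  case 0
  have "work 0 \<omega> = (\<Sum>i\<in>UNIV. real (q\<^sub>0 i) / p i)" for \<omega>
    by (simp add: work_def Q_def obs_def)
  then show ?case by simp
next
  case (Suc t)
  obtain B where B: "\<And>t. integrable (law I) (\<lambda>\<omega>. (inflow t \<omega>)\<^sup>2)"
    using inflow_second_moment by metis
  show ?case
  proof (rule Bochner_Integration.integrable_bound)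
    show "integrable (law I) (\<lambda>\<omega>. 2 * (work t \<omega>)\<^sup>2 + 2 * (inflow t \<omega>)\<^sup>2)"
      using Suc B by simp
    show "AE \<omega> in law I. norm ((work (Suc t) \<omega>)\<^sup>2) \<le> norm (2 * (work t \<omega>)\<^sup>2 + 2 * (inflow t \<omega>)\<^sup>2)"
    proof (rule AE_I2)
      fix \<omega>
      have "(work (Suc t) \<omega>)\<^sup>2 \<le> (work t \<omega> + inflow t \<omega>)\<^sup>2"
        using work_nonneg[of "Suc t" \<omega>] outflow_nonneg[of t \<omega>]
        by (intro power_mono) (simp_all add: work_Suc)
      also have "\<dots> \<le> 2 * (work t \<omega>)\<^sup>2 + 2 * (inflow t \<omega>)\<^sup>2"
        using zero_le_power2[of "work t \<omega> - inflow t \<omega>"]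
        by (simp add: power2_eq_square algebra_simps)
      finally show "norm ((work (Suc t) \<omega>)\<^sup>2) \<le> norm (2 * (work t \<omega>)\<^sup>2 + 2 * (inflow t \<omega>)\<^sup>2)"
        by simp
    qed
  qed measurable
qed

lemma integrable_work: "integrable (law I) (work t)"
  by (rule square_integrable_imp_integrable[OF _ integrable_work_square]) measurable

lemma Q_le_work: "real (Q i t \<omega>) \<le> p i * work t \<omega>"
proof -
  have "real (Q i t \<omega>) / p i \<le> work t \<omega>"
    unfolding work_def
    by (rule member_le_sum[where f = "\<lambda>i. real (Q i t \<omega>) / p i"])
      (auto intro!: divide_nonneg_pos p_pos)
  then show ?thesis using p_pos[of i] by (simp add: divide_le_eq mult.commute)
qed

lemma integrable_Q: "integrable (law I) (\<lambda>\<omega>. real (Q i t \<omega>))"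
proof (rule Bochner_Integration.integrable_bound)
  show "integrable (law I) (\<lambda>\<omega>. p i * work t \<omega>)" by (simp add: integrable_work)
  show "AE \<omega> in law I. norm (real (Q i t \<omega>)) \<le> norm (p i * work t \<omega>)"
    using order_trans[OF Q_le_work abs_ge_self] by simp
qed measurable

lemma integrable_outflow: "integrable (law I) (outflow t)"
  using outflow_nonneg outflow_le[of t]
  by (intro integrable_const_bound[of _ "\<Sum>i\<in>UNIV. 1 / p i"]) auto

lemma integrable_inflow: "integrable (law I) (inflow t)"
  unfolding inflow_def using integrable_arrival by (simp add: source_value_eq)

lemma expectation_inflow: "expectation (inflow t) = load"
  unfolding inflow_def load_def
  by (subst Bochner_Integration.integral_sum)
    (simp_all only: integral_divide_zero integrable_divide integrable_arrival[unfolded source_value_eq]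
      expectation_arrival[unfolded source_value_eq])

lemma fresh_sources: "t \<le> u \<Longrightarrow> Arrival i u \<notin> past t" "t \<le> u \<Longrightarrow> Channel i u \<notin> past t"
  by (auto simp: past_def)

lemma expectation_mult_inflow:
  assumes X: "X \<in> borel_measurable (info (past t))" "integrable (law I) X" and "t \<le> u"
  shows "integrable (law I) (\<lambda>\<omega>. X \<omega> * inflow u \<omega>)"
    and "expectation (\<lambda>\<omega>. X \<omega> * inflow u \<omega>) = expectation X * load"
proof -
  have eq: "(\<lambda>\<omega>. X \<omega> * inflow u \<omega>) = (\<lambda>\<omega>. \<Sum>i\<in>UNIV. (X \<omega> * source_value I (Arrival i u) \<omega>) / p i)"
    by (simp add: inflow_def sum_distrib_left)
  have int: "integrable (law I) (\<lambda>\<omega>. X \<omega> * source_value I (Arrival i u) \<omega>)" for i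
    by (rule integrable_mult_source[OF X(1) fresh_sources(1)[OF \<open>t \<le> u\<close>] X(2) integrable_arrival])
  show "integrable (law I) (\<lambda>\<omega>. X \<omega> * inflow u \<omega>)"
    unfolding eq by (intro Bochner_Integration.integrable_sum integrable_divide int)
  show "expectation (\<lambda>\<omega>. X \<omega> * inflow u \<omega>) = expectation X * load"
    unfolding eq load_def sum_distrib_left
    by (subst Bochner_Integration.integral_sum)
      (simp_all only: integrable_divide int integral_divide_zero
        expectation_mult_source[OF X(1) fresh_sources(1)[OF \<open>t \<le> u\<close>] X(2) integrable_arrival]
        expectation_arrival times_divide_eq_right)
qed

lemma expectation_mult_channel:
  assumes X: "X \<in> borel_measurable (info (past t))" "integrable (law I) X" and "t \<le> u"
  shows "integrable (law I) (\<lambda>\<omega>. X \<omega> * of_bool (channels I i u \<omega>))"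
    and "expectation (\<lambda>\<omega>. X \<omega> * of_bool (channels I i u \<omega>)) = expectation X * p i"
  using expectation_mult_source[OF X(1) fresh_sources(2)[OF \<open>t \<le> u\<close>] X(2) integrable_channel]
    integrable_mult_source[OF X(1) fresh_sources(2)[OF \<open>t \<le> u\<close>] X(2) integrable_channel]
  by (simp_all only: expectation_channel[unfolded source_value_eq] source_value_eq)

section \<open>Stability and expected work\<close>

lemma stable_iff:
  "stable D s\<^sub>0 q\<^sub>0 I \<pi> \<longleftrightarrow>
    limsup (\<lambda>t. ennreal ((\<Sum>\<tau><t. \<Sum>i\<in>UNIV. expectation (\<lambda>\<omega>. real (Q i \<tau> \<omega>))) / t)) < \<infinity>"
proof -
  have nn: "(\<integral>\<^sup>+\<omega>. of_nat (queue_length D s\<^sub>0 q\<^sub>0 I \<pi> i \<tau> \<omega>) \<partial>law I)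
      = ennreal (expectation (\<lambda>\<omega>. real (Q i \<tau> \<omega>)))" for i \<tau>
    using nn_integral_eq_integral[OF integrable_Q[of i \<tau>]]
    by (simp add: queue_length_def Q_def obs_def ennreal_of_nat_eq_real_of_nat)
  have "\<forall>\<^sub>F t in sequentially.
    (\<Sum>\<tau><t. \<Sum>i\<in>UNIV. \<integral>\<^sup>+\<omega>. of_nat (queue_length D s\<^sub>0 q\<^sub>0 I \<pi> i \<tau> \<omega>) \<partial>law I) / of_nat t
    = ennreal ((\<Sum>\<tau><t. \<Sum>i\<in>UNIV. expectation (\<lambda>\<omega>. real (Q i \<tau> \<omega>))) / t)"
    using eventually_gt_at_top[of 0]
  proof eventually_elim
    case (elim t)
    have "(\<Sum>\<tau><t. \<Sum>i\<in>UNIV. ennreal (expectation (\<lambda>\<omega>. real (Q i \<tau> \<omega>))))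
        = ennreal (\<Sum>\<tau><t. \<Sum>i\<in>UNIV. expectation (\<lambda>\<omega>. real (Q i \<tau> \<omega>)))"
      by (simp add: sum_nonneg)
    then show ?case
      unfolding nn using elim by (simp add: sum_nonneg divide_ennreal ennreal_of_nat_eq_real_of_nat)
  qed
  then show ?thesis
    unfolding stable_def by (subst Limsup_eq) auto
qed

lemma stable_if_work_bounded:
  fixes C C' :: real
  assumes "\<And>T. (\<Sum>t<T. expectation (work t)) \<le> C * T + C'"
  shows "stable D s\<^sub>0 q\<^sub>0 I \<pi>"
proof -
  let ?s = "\<lambda>T. \<Sum>\<tau><T. \<Sum>i\<in>UNIV. expectation (\<lambda>\<omega>. real (Q i \<tau> \<omega>))"
  let ?P = "\<Sum>i\<in>UNIV. p i"
  have P: "0 \<le> ?P" by (intro sum_nonneg less_imp_le p_pos)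
  have Q: "expectation (\<lambda>\<omega>. real (Q i t \<omega>)) \<le> p i * expectation (work t)" for i t
  proof -
    have "expectation (\<lambda>\<omega>. real (Q i t \<omega>)) \<le> expectation (\<lambda>\<omega>. p i * work t \<omega>)"
      by (intro integral_mono integrable_Q integrable_mult_right integrable_work Q_le_work)
    then show ?thesis by simp
  qed
  have s: "?s T \<le> ?P * (C * T + C')" for T :: nat
  proof -
    have "?s T \<le> (\<Sum>\<tau><T. \<Sum>i\<in>UNIV. p i * expectation (work \<tau>))"
      by (intro sum_mono Q)
    also have "\<dots> = ?P * (\<Sum>\<tau><T. expectation (work \<tau>))"
      by (simp add: sum_distrib_left sum_distrib_right)
    also have "\<dots> \<le> ?P * (C * T + C')" by (intro mult_left_mono assms P)
    finally show ?thesis .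
  qed
  have "limsup (\<lambda>T. ennreal (?s T / T)) \<le> ennreal (?P * (C + \<bar>C'\<bar>))"
  proof (rule Limsup_bounded)
    show "\<forall>\<^sub>F T in sequentially. ennreal (?s T / T) \<le> ennreal (?P * (C + \<bar>C'\<bar>))"
      using eventually_gt_at_top[of 0]
    proof eventually_elim
      case (elim T)
      have "C' \<le> \<bar>C'\<bar> * T" using elim abs_ge_self[of C'] mult_left_mono[of 1 "real T" "\<bar>C'\<bar>"] by simp
      then have "?P * (C * T + C') \<le> ?P * ((C + \<bar>C'\<bar>) * T)"
        by (intro mult_left_mono P) (simp add: algebra_simps)
      with s[of T] have "?s T / T \<le> ?P * (C + \<bar>C'\<bar>)"
        using elim by (simp add: divide_le_eq mult.assoc)
      then show ?case by (rule ennreal_leI)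
    qed
  qed
  then show ?thesis unfolding stable_iff by (rule le_less_trans) simp
qed

text \<open>
  The decision of a control algorithm may depend on the current channel states, but presence at a queue
  does not, and a service at \<open>i\<close> requires presence at \<open>i\<close> and an ON channel.  Presence at \<open>i\<close>
  contributes \<open>p i\<close> services, that is one unit of work, and the server is at one queue at most.
\<close>

lemma expectation_outflow_le_1: "expectation (outflow t) \<le> 1"
proof -
  define here where "here i \<omega> = (of_bool (delay (obs t \<omega>) = 0 \<and> loc (obs t \<omega>) = i) :: real)" for i \<omega>
  have here_past: "here i \<in> borel_measurable (info (past t))" for i
  proof -
    note [measurable] = state_measurable_past[where t = t]
    show ?thesis unfolding here_def by measurable
  qed
  note [measurable] = here_past[THEN info_measurable]
  have here_int: "integrable (law I) (here i)" for i
    by (rule integrable_const_bound[of _ 1]) (auto simp: here_def)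
  note hc = expectation_mult_channel[OF here_past here_int order_refl]
  have "outflow t \<omega> \<le> (\<Sum>i\<in>UNIV. here i \<omega> * of_bool (channels I i t \<omega>) / p i)" for \<omega>
    unfolding outflow_def
    by (intro sum_mono divide_right_mono) (auto simp: serv_eq here_def p_pos less_imp_le)
  then have "expectation (outflow t)
      \<le> expectation (\<lambda>\<omega>. \<Sum>i\<in>UNIV. here i \<omega> * of_bool (channels I i t \<omega>) / p i)"
    by (intro integral_mono integrable_outflow Bochner_Integration.integrable_sum
        integrable_divide hc)
  also have "\<dots> = (\<Sum>i\<in>UNIV. expectation (here i) * p i / p i)"
    by (subst Bochner_Integration.integral_sum)
      (simp_all only: integrable_divide integral_divide_zero hc)
  also have "\<dots> = (\<Sum>i\<in>UNIV. expectation (here i))"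
    using p_pos by (intro sum.cong refl nonzero_mult_div_cancel_right) (metis less_irrefl)
  also have "\<dots> = expectation (\<lambda>\<omega>. \<Sum>i\<in>UNIV. here i \<omega>)"
    by (rule Bochner_Integration.integral_sum[symmetric]) (rule here_int)
  also have "\<dots> \<le> expectation (\<lambda>_. 1)"
  proof (rule integral_mono)
    show "(\<Sum>i\<in>UNIV. here i \<omega>) \<le> 1" for \<omega>
    proof -
      have "(\<Sum>i\<in>UNIV. here i \<omega>) \<le> (\<Sum>i\<in>UNIV. if i = loc (obs t \<omega>) then 1 else 0)"
        by (rule sum_mono) (auto simp: here_def)
      then show ?thesis by simp
    qed
  qed (simp_all add: here_int)
  also have "\<dots> = 1" by (simp add: prob_space)
  finally show ?thesis .
qed

lemma expectation_work_ge: "(load - 1) * t \<le> expectation (work t)"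
proof (induction t)
  case 0
  show ?case using work_nonneg by (simp add: Bochner_Integration.integral_nonneg)
next
  case (Suc t)
  have "expectation (work (Suc t)) = expectation (\<lambda>\<omega>. work t \<omega> + (inflow t \<omega> - outflow t \<omega>))"
    by (rule Bochner_Integration.integral_cong) (simp_all only: work_Suc)
  also have "\<dots> = expectation (work t) + (load - expectation (outflow t))"
    by (simp add: integrable_work integrable_inflow integrable_outflow expectation_inflow)
  finally have "expectation (work (Suc t)) \<ge> expectation (work t) + (load - 1)"
    using expectation_outflow_le_1[of t] by linarith
  then show ?case
    using Suc by (simp add: distrib_left)
qed

theorem stable_imp_load_le_1:
  assumes "stable D s\<^sub>0 q\<^sub>0 I \<pi>"
  shows "load \<le> 1"
proof (rule ccontr)
  let ?s = "\<lambda>T. \<Sum>\<tau><T. \<Sum>i\<in>UNIV. expectation (\<lambda>\<omega>. real (Q i \<tau> \<omega>))"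
  let ?P = "\<Sum>i\<in>UNIV. 1 / p i"
  assume "\<not> load \<le> 1"
  then have e: "0 < load - 1" by simp
  have P: "0 < ?P" by (intro sum_pos) (auto simp: p_pos)
  obtain b where b: "0 \<le> b" "limsup (\<lambda>t. ennreal (?s t / t)) = ennreal b"
    using assms unfolding stable_iff by (cases "limsup (\<lambda>t. ennreal (?s t / t))") auto
  define B where "B = b + 1"
  have "limsup (\<lambda>t. ennreal (?s t / t)) < ennreal B"
    unfolding b(2) B_def using b(1) by (simp add: ennreal_less_iff)
  then have ev: "\<forall>\<^sub>F t in sequentially. ennreal (?s t / t) < ennreal B"
    by (rule Limsup_lessD)
  have work: "expectation (work t) \<le> ?P * (\<Sum>i\<in>UNIV. expectation (\<lambda>\<omega>. real (Q i t \<omega>)))" for t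
  proof -
    have "expectation (work t) = (\<Sum>i\<in>UNIV. expectation (\<lambda>\<omega>. real (Q i t \<omega>)) * (1 / p i))"
      unfolding work_def by (simp add: integrable_Q)
    also have "\<dots> \<le> (\<Sum>i\<in>UNIV. expectation (\<lambda>\<omega>. real (Q i t \<omega>)) * ?P)"
      by (intro sum_mono mult_left_mono member_le_sum[where f = "\<lambda>i. 1 / p i"])
        (auto simp: p_pos less_imp_le)
    finally show ?thesis by (simp add: sum_distrib_left mult.commute)
  qed
  have lower: "(load - 1) * (real T * (real T - 1) / 2) \<le> ?P * ?s T" for T
  proof -
    \<comment> \<open>Linear growth of the mean work makes its sum grow quadratically.\<close>
    have "(\<Sum>t<T. real t) = real T * (real T - 1) / 2"
      by (induction T) (simp_all add: field_simps)
    then have "(load - 1) * (real T * (real T - 1) / 2) = (\<Sum>t<T. (load - 1) * t)"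
      unfolding sum_distrib_left[symmetric] by simp
    also have "\<dots> \<le> (\<Sum>t<T. ?P * (\<Sum>i\<in>UNIV. expectation (\<lambda>\<omega>. real (Q i t \<omega>))))"
      by (intro sum_mono order_trans[OF expectation_work_ge work])
    finally show ?thesis by (simp add: sum_distrib_left)
  qed
  have "\<forall>\<^sub>F T in sequentially. (load - 1) * (real T - 1) / 2 \<le> ?P * \<bar>B\<bar>"
    using ev eventually_gt_at_top[of 0]
  proof eventually_elim
    case (elim T)
    have "?s T / T < B"
    proof (rule ccontr)
      assume "\<not> ?s T / T < B"
      then have "ennreal B \<le> ennreal (?s T / T)" by (intro ennreal_leI) simp
      with elim(1) show False by simp
    qed
    also have "\<dots> \<le> \<bar>B\<bar>" by simp
    finally have "?s T / T < \<bar>B\<bar>" .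
    then have "?s T \<le> \<bar>B\<bar> * T" using elim(2) by (simp add: divide_less_eq)
    then have "?P * ?s T \<le> ?P * (\<bar>B\<bar> * T)" using P by (intro mult_left_mono) auto
    with lower[of T] have "((load - 1) * (real T - 1) / 2) * real T \<le> (?P * \<bar>B\<bar>) * real T"
      by (simp add: field_simps)
    then show ?case using elim(2) by simp
  qed
  moreover have "\<forall>\<^sub>F T in sequentially. 2 * (?P * \<bar>B\<bar>) / (load - 1) + 1 < real T"
    using filterlim_real_sequentially unfolding filterlim_at_top_dense by blast
  ultimately have "\<forall>\<^sub>F T :: nat in sequentially. False"
  proof eventually_elim
    case (elim T)
    have "2 * (?P * \<bar>B\<bar>) / (load - 1) < real T - 1" using elim(2) by linarith
    then have "2 * (?P * \<bar>B\<bar>) < (real T - 1) * (load - 1)"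
      using e by (simp only: divide_less_eq if_True)
    with elim(1) show False by (simp only: mult.commute)
  qed
  then show False by simp
qed

end

section \<open>Cyclic clearing policies are stable below full load\<close>

text \<open>
  Cyclic clearing policies whose decisions ignore the current channel states.  Excluding fixed points of
  \<open>nx\<close> ensures that a decision to stay is never a decision to switch to the next queue, so that the
  server stays only at nonempty queues.
\<close>

locale clearing_queues = controlled_queues p r I D s\<^sub>0 q\<^sub>0 \<pi>
  for p :: "'n::finite \<Rightarrow> real" and r :: "real ^ 'n" and I :: "('w, 'n) inputs"
    and D s\<^sub>0 q\<^sub>0 \<pi> +
  fixes nx :: "'n \<Rightarrow> 'n"
  assumes channel_blind: "\<And>u q c c' l d h. \<pi> u (Obs q c l d # h) = \<pi> u (Obs q c' l d # h)"
    and clearing: "clearing_policy D nx s\<^sub>0 q\<^sub>0 I \<pi>"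
    and cyclic: "cyclic_order nx"
    and no_fixpoint: "\<And>i. nx i \<noteq> i"
    and load_less_1: "load < 1"
begin

definition staying :: "'n \<Rightarrow> nat \<Rightarrow> 'w \<Rightarrow> real" where
  "staying i t \<omega> = of_bool (delay (obs t \<omega>) = 0 \<and> loc (obs t \<omega>) = i \<and> decision t \<omega> = i)"

lemma decision_measurable_past: "decision t \<in> info (past t) \<rightarrow>\<^sub>M count_space UNIV"
proof -
  have "decision t \<omega> = \<pi> (seed I \<omega>) (with_channels (\<lambda>_. False) (before_channels t \<omega>))" for \<omega>
    unfolding decision_def hist_with_channels with_channels_def
    by (cases "before_channels t \<omega>") (simp, rule channel_blind)
  moreover have "(\<lambda>\<omega>. \<pi> (seed I \<omega>) (with_channels (\<lambda>_. False) (before_channels t \<omega>)))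
      \<in> info (past t) \<rightarrow>\<^sub>M count_space UNIV"
    by (rule policy_measurable_info[OF _ measurable_compose[OF before_channels_measurable]])
      (simp_all add: past_def)
  ultimately show ?thesis by (simp cong: measurable_cong)
qed

lemma staying_measurable_past: "staying i t \<in> borel_measurable (info (past t))"
proof -
  have "staying i t = (\<lambda>\<omega>. case (delay (obs t \<omega>), loc (obs t \<omega>), decision t \<omega>)
      of (d, l, j) \<Rightarrow> of_bool (d = 0 \<and> l = i \<and> j = i))"
    by (simp add: staying_def fun_eq_iff)
  also have "\<dots> \<in> borel_measurable (info (past t))"
    by (rule measurable_compose[where N = "count_space UNIV"])
      (intro measurable_pair_count_space state_measurable_past decision_measurable_past, simp)
  finally show ?thesis .
qed

lemma staying_measurable [measurable]: "staying i t \<in> borel_measurable (law I)"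
  by (rule info_measurable[OF staying_measurable_past])

lemma clearing_path:
  obtains todo where
    "cyclic_clearing_path D nx (\<lambda>t. obs t \<omega>) (\<lambda>t. decision t \<omega>) (\<lambda>t i. arrivals I i t \<omega>) todo"
  using clearing unfolding clearing_policy_def obs_def decision_def by blast

text \<open>
  In every slot in which the server stays, an ON channel is the only further condition for a service,
  since the queue is nonempty.
\<close>

lemma serv_staying: "real (serv i t \<omega>) = staying i t \<omega> * of_bool (channels I i t \<omega>)"
proof -
  obtain todo where "cyclic_clearing_path D nx (\<lambda>t. obs t \<omega>) (\<lambda>t. decision t \<omega>)
      (\<lambda>t i. arrivals I i t \<omega>) todo"
    by (rule clearing_path)
  from cyclic_clearing_path.decision[OF this, of t]
  have "0 < Q i t \<omega>" if "delay (obs t \<omega>) = 0" "loc (obs t \<omega>) = i" "decision t \<omega> = i"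
    using that no_fixpoint[of i] by (auto simp: Q_def)
  then show ?thesis by (auto simp: serv_eq staying_def)
qed

lemma sum_staying:
  "(\<Sum>i\<in>UNIV. staying i t \<omega>) = of_bool (delay (obs t \<omega>) = 0 \<and> decision t \<omega> = loc (obs t \<omega>))"
proof -
  have "(\<Sum>i\<in>UNIV. staying i t \<omega>) = (\<Sum>i\<in>UNIV. if i = loc (obs t \<omega>)
      then of_bool (delay (obs t \<omega>) = 0 \<and> decision t \<omega> = loc (obs t \<omega>)) else 0)"
    by (rule sum.cong) (auto simp: staying_def)
  then show ?thesis by simp
qed

lemma few_switching_slots:
  obtains K :: nat where "\<And>n t \<omega>. n \<le> (\<Sum>i\<in>UNIV. Q i t \<omega>) \<Longrightarrow>
    real n \<le> (\<Sum>u<n. \<Sum>i\<in>UNIV. staying i (t + u) \<omega>) + K"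
proof -
  obtain N where N: "\<And>i k. \<exists>m<N. (nx ^^ m) i = k"
    using cyclic_order_bounded_reach[OF cyclic] by blast
  let ?K = "Suc (\<Sum>i\<in>UNIV. \<Sum>k\<in>UNIV. D i k) * Suc N"
  have "real n \<le> (\<Sum>u<n. \<Sum>i\<in>UNIV. staying i (t + u) \<omega>) + ?K"
    if "n \<le> (\<Sum>i\<in>UNIV. Q i t \<omega>)" for n t \<omega>
  proof -
    obtain todo where "cyclic_clearing_path D nx (\<lambda>t. obs t \<omega>) (\<lambda>t. decision t \<omega>)
        (\<lambda>t i. arrivals I i t \<omega>) todo"
      by (rule clearing_path)
    then interpret cyclic_clearing_path D nx "\<lambda>t. obs t \<omega>" "\<lambda>t. decision t \<omega>"
      "\<lambda>t i. arrivals I i t \<omega>" todo .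
    have "real n \<le> real ((\<Sum>u<n. of_bool (stays (t + u))) + ?K)"
      using that mostly_stays[OF N, of n t] unfolding Q_def of_nat_le_iff by blast
    then show ?thesis
      unfolding sum_staying stays_def by (simp del: sum_of_bool_eq)
  qed
  then show ?thesis by (rule that)
qed

lemma
  assumes "t \<le> u"
  shows integrable_work_staying: "integrable (law I) (\<lambda>\<omega>. work t \<omega> * staying i u \<omega>)"
    and work_staying_measurable_past:
      "(\<lambda>\<omega>. work t \<omega> * staying i u \<omega>) \<in> borel_measurable (info (past u))"
proof -
  show "integrable (law I) (\<lambda>\<omega>. work t \<omega> * staying i u \<omega>)"
    by (rule Bochner_Integration.integrable_bound[OF integrable_work[of t]])
      (auto simp: staying_def)
  show "(\<lambda>\<omega>. work t \<omega> * staying i u \<omega>) \<in> borel_measurable (info (past u))"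
    by (intro borel_measurable_times staying_measurable_past
        info_mono[OF work_measurable_past past_mono[OF assms]])
qed

text \<open>
  The channel states of slot \<open>u\<close> are fresh relative to the work in the earlier slot \<open>t\<close> and to the
  decision to stay in \<open>u\<close>.  Staying therefore removes one unit of work per slot on average, even when
  weighted by \<open>w(t)\<close>.
\<close>

lemma expectation_work_outflow:
  assumes "t \<le> u"
  shows "integrable (law I) (\<lambda>\<omega>. work t \<omega> * outflow u \<omega>)"
    and "expectation (\<lambda>\<omega>. work t \<omega> * outflow u \<omega>)
      = expectation (\<lambda>\<omega>. work t \<omega> * (\<Sum>i\<in>UNIV. staying i u \<omega>))"
proof -
  note c = expectation_mult_channel[OF work_staying_measurable_past[OF assms]
      integrable_work_staying[OF assms] order_refl]
  have eq: "(\<lambda>\<omega>. work t \<omega> * outflow u \<omega>)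
      = (\<lambda>\<omega>. \<Sum>i\<in>UNIV. work t \<omega> * staying i u \<omega> * of_bool (channels I i u \<omega>) / p i)"
    by (simp add: outflow_def serv_staying sum_distrib_left mult.assoc)
  show "integrable (law I) (\<lambda>\<omega>. work t \<omega> * outflow u \<omega>)"
    unfolding eq by (intro Bochner_Integration.integrable_sum integrable_divide c)
  have "expectation (\<lambda>\<omega>. work t \<omega> * outflow u \<omega>)
      = (\<Sum>i\<in>UNIV. expectation (\<lambda>\<omega>. work t \<omega> * staying i u \<omega>) * p i / p i)"
    unfolding eq by (subst Bochner_Integration.integral_sum)
      (simp_all only: integrable_divide integral_divide_zero c)
  also have "\<dots> = (\<Sum>i\<in>UNIV. expectation (\<lambda>\<omega>. work t \<omega> * staying i u \<omega>))"
    using p_pos by (intro sum.cong refl nonzero_mult_div_cancel_right) (metis less_irrefl)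
  also have "\<dots> = expectation (\<lambda>\<omega>. \<Sum>i\<in>UNIV. work t \<omega> * staying i u \<omega>)"
    by (rule Bochner_Integration.integral_sum[symmetric]) (rule integrable_work_staying[OF assms])
  finally show "expectation (\<lambda>\<omega>. work t \<omega> * outflow u \<omega>)
      = expectation (\<lambda>\<omega>. work t \<omega> * (\<Sum>i\<in>UNIV. staying i u \<omega>))"
    by (simp add: sum_distrib_left)
qed

text \<open>
  Expanding \<open>w(t + n)\<^sup>2 = w(t)\<^sup>2 + 2 w(t) \<Delta>(t) + \<Delta>(t)\<^sup>2\<close>, where \<open>\<Delta>(t)\<close> is the change of the work
  over \<open>n\<close> slots, the last term has bounded mean.  In the mean of the mixed term, \<open>\<Delta>(t)\<close> may be
  replaced by \<open>n \<rho>\<close> minus the number of slots in which the server stays; this is at most \<open>-1\<close> if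
  there are at least \<open>n\<close> packets in slot \<open>t\<close>, and otherwise \<open>w(t)\<close> itself is bounded.
\<close>

lemma square_drift:
  obtains n :: nat and C :: real where
    "\<And>t. expectation (\<lambda>\<omega>. (work (t + n) \<omega>)\<^sup>2) + 2 * expectation (work t)
        \<le> expectation (\<lambda>\<omega>. (work t \<omega>)\<^sup>2) + C"
proof -
  obtain K where K: "\<And>n t \<omega>. n \<le> (\<Sum>i\<in>UNIV. Q i t \<omega>) \<Longrightarrow>
      real n \<le> (\<Sum>u<n. \<Sum>i\<in>UNIV. staying i (t + u) \<omega>) + real K"
    by (rule few_switching_slots) blast
  obtain B where B_int: "\<And>t. integrable (law I) (\<lambda>\<omega>. (inflow t \<omega>)\<^sup>2)"
    and B: "\<And>t. expectation (\<lambda>\<omega>. (inflow t \<omega>)\<^sup>2) \<le> B"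
    by (rule inflow_second_moment) blast
  define n where "n = nat \<lceil>(K + 1) / (1 - load)\<rceil>"
  have n: "K + 1 \<le> n * (1 - load)"
  proof -
    have "(K + 1) / (1 - load) \<le> n" unfolding n_def by linarith
    then show ?thesis using load_less_1 by (simp add: pos_divide_le_eq)
  qed
  define P where "P = (\<Sum>i\<in>UNIV. 1 / p i)"
  have P: "0 < P" unfolding P_def by (intro sum_pos) (auto simp: p_pos)
  \<comment> \<open>With fewer than \<open>n\<close> packets the work is at most \<open>P * n\<close>, and then the mixed term plus \<open>w(t)\<close>
      is at most \<open>M\<close>.\<close>
  define M where "M = P * n * (1 + n * load)"
  define \<Delta> where "\<Delta> t \<omega> = (\<Sum>u<n. inflow (t + u) \<omega> - outflow (t + u) \<omega>)" for t \<omega>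
  define \<Sigma> where "\<Sigma> t \<omega> = (\<Sum>u<n. \<Sum>i\<in>UNIV. staying i (t + u) \<omega>)" for t \<omega>
  have pointwise: "work t \<omega> * (n * load - \<Sigma> t \<omega>) \<le> M - work t \<omega>" for t \<omega>
  proof (cases "n \<le> (\<Sum>i\<in>UNIV. Q i t \<omega>)")
    case True
    have "n * load - \<Sigma> t \<omega> \<le> - 1"
      using K[OF True] n unfolding \<Sigma>_def by (simp add: algebra_simps)
    then have "work t \<omega> * (n * load - \<Sigma> t \<omega>) \<le> work t \<omega> * - 1"
      by (intro mult_left_mono work_nonneg)
    moreover have "0 \<le> M" unfolding M_def using P load_nonneg by simp
    ultimately show ?thesis by simp
  next
    case False
    have "work t \<omega> \<le> (\<Sum>i\<in>UNIV. real (Q i t \<omega>) * P)"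
      unfolding work_def divide_inverse
      by (intro sum_mono mult_left_mono)
        (auto simp: P_def p_pos less_imp_le divide_inverse intro!: member_le_sum[where f = "\<lambda>i. inverse (p i)"])
    also have "\<dots> = P * real (\<Sum>i\<in>UNIV. Q i t \<omega>)" by (simp add: sum_distrib_left mult.commute)
    also have "\<dots> \<le> P * n"
      using False P by (intro mult_left_mono) (simp_all del: of_nat_sum)
    finally have w: "work t \<omega> \<le> P * n" .
    have "0 \<le> \<Sigma> t \<omega>" unfolding \<Sigma>_def staying_def by (intro sum_nonneg) simp
    then have "work t \<omega> * (1 + (n * load - \<Sigma> t \<omega>)) \<le> work t \<omega> * (1 + n * load)"
      by (intro mult_left_mono work_nonneg) simp
    also have "\<dots> \<le> M"
      unfolding M_def using load_nonneg by (intro mult_right_mono w) simp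
    finally show ?thesis by (simp add: distrib_left)
  qed
  define E where "E t \<omega> = n * (\<Sum>u<n. (inflow (t + u) \<omega>)\<^sup>2 + P\<^sup>2)" for t \<omega>
  have \<Delta>_le: "(\<Delta> t \<omega>)\<^sup>2 \<le> E t \<omega>" for t \<omega>
  proof -
    have "(inflow u \<omega> - outflow u \<omega>)\<^sup>2 \<le> (inflow u \<omega>)\<^sup>2 + P\<^sup>2" for u
    proof -
      have "(outflow u \<omega>)\<^sup>2 \<le> P\<^sup>2"
        using outflow_nonneg outflow_le unfolding P_def by (intro power_mono)
      moreover have "0 \<le> inflow u \<omega> * outflow u \<omega>"
        by (intro mult_nonneg_nonneg inflow_nonneg outflow_nonneg)
      ultimately show ?thesis by (simp add: power2_diff)
    qed
    then have "(\<Sum>u<n. (inflow (t + u) \<omega> - outflow (t + u) \<omega>)\<^sup>2) * n \<le> E t \<omega>"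
      unfolding E_def by (subst mult.commute) (intro mult_left_mono sum_mono, auto)
    moreover have "(\<Delta> t \<omega>)\<^sup>2 \<le> (\<Sum>u<n. (inflow (t + u) \<omega> - outflow (t + u) \<omega>)\<^sup>2) * n"
      unfolding \<Delta>_def
      using sum_squared_le_sum_of_squares[of "\<lambda>u. inflow (t + u) \<omega> - outflow (t + u) \<omega>" "{..<n}"]
      by simp
    ultimately show ?thesis by simp
  qed
  have E_int: "integrable (law I) (E t)" for t
    unfolding E_def using B_int by simp
  have E_le: "expectation (E t) \<le> n * (n * (B + P\<^sup>2))" for t
  proof -
    have "expectation (E t) = n * (\<Sum>u<n. expectation (\<lambda>\<omega>. (inflow (t + u) \<omega>)\<^sup>2) + P\<^sup>2)"
      unfolding E_def using B_int by (simp add: prob_space)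
    also have "\<dots> \<le> n * (\<Sum>u<n. B + P\<^sup>2)"
      by (intro mult_left_mono sum_mono add_right_mono B) simp
    finally show ?thesis by simp
  qed
  have cross_int: "integrable (law I) (\<lambda>\<omega>. work t \<omega> * \<Delta> t \<omega>)"
    and cross: "expectation (\<lambda>\<omega>. work t \<omega> * \<Delta> t \<omega>)
        = expectation (\<lambda>\<omega>. work t \<omega> * (n * load - \<Sigma> t \<omega>))"
    and \<Sigma>_int: "integrable (law I) (\<lambda>\<omega>. work t \<omega> * (n * load - \<Sigma> t \<omega>))" for t
  proof -
    have le: "t \<le> t + u" for u by simp
    note i = expectation_mult_inflow[OF work_measurable_past integrable_work le]
    note o = expectation_work_outflow[OF le]
    have s: "integrable (law I) (\<lambda>\<omega>. work t \<omega> * (\<Sum>i\<in>UNIV. staying i (t + u) \<omega>))" for u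
      unfolding sum_distrib_left by (intro Bochner_Integration.integrable_sum integrable_work_staying le)
    have eq: "(\<lambda>\<omega>. work t \<omega> * \<Delta> t \<omega>)
        = (\<lambda>\<omega>. \<Sum>u<n. work t \<omega> * inflow (t + u) \<omega> - work t \<omega> * outflow (t + u) \<omega>)"
      by (simp add: \<Delta>_def sum_distrib_left right_diff_distrib)
    have eq': "(\<lambda>\<omega>. work t \<omega> * (n * load - \<Sigma> t \<omega>))
        = (\<lambda>\<omega>. \<Sum>u<n. work t \<omega> * load - work t \<omega> * (\<Sum>i\<in>UNIV. staying i (t + u) \<omega>))"
      by (simp add: \<Sigma>_def sum_distrib_left right_diff_distrib sum_subtractf mult.left_commute)
    show "integrable (law I) (\<lambda>\<omega>. work t \<omega> * \<Delta> t \<omega>)"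
      unfolding eq by (intro Bochner_Integration.integrable_sum Bochner_Integration.integrable_diff i o)
    show "integrable (law I) (\<lambda>\<omega>. work t \<omega> * (n * load - \<Sigma> t \<omega>))"
      unfolding eq' by (intro Bochner_Integration.integrable_sum Bochner_Integration.integrable_diff s
          integrable_mult_left integrable_work)
    show "expectation (\<lambda>\<omega>. work t \<omega> * \<Delta> t \<omega>) = expectation (\<lambda>\<omega>. work t \<omega> * (n * load - \<Sigma> t \<omega>))"
      unfolding eq eq'
      by (subst (1 2) Bochner_Integration.integral_sum)
        (simp_all only: Bochner_Integration.integrable_diff Bochner_Integration.integral_diff
          i o s integrable_mult_left integrable_work integral_mult_left_zero)
  qed
  have \<Delta>_int: "integrable (law I) (\<lambda>\<omega>. (\<Delta> t \<omega>)\<^sup>2)" for t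
  proof (rule Bochner_Integration.integrable_bound[OF E_int])
    show "(\<lambda>\<omega>. (\<Delta> t \<omega>)\<^sup>2) \<in> borel_measurable (law I)" unfolding \<Delta>_def by measurable
    show "AE \<omega> in law I. norm ((\<Delta> t \<omega>)\<^sup>2) \<le> norm (E t \<omega>)"
      using order_trans[OF \<Delta>_le abs_ge_self] by simp
  qed
  have "expectation (\<lambda>\<omega>. (work (t + n) \<omega>)\<^sup>2) + 2 * expectation (work t)
      \<le> expectation (\<lambda>\<omega>. (work t \<omega>)\<^sup>2) + (2 * M + n * (n * (B + P\<^sup>2)))" for t
  proof -
    have "expectation (\<lambda>\<omega>. (work (t + n) \<omega>)\<^sup>2)
        = expectation (\<lambda>\<omega>. (work t \<omega>)\<^sup>2 + 2 * (work t \<omega> * \<Delta> t \<omega>) + (\<Delta> t \<omega>)\<^sup>2)"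
      unfolding work_add \<Delta>_def by (simp add: power2_sum algebra_simps)
    also have "\<dots> = expectation (\<lambda>\<omega>. (work t \<omega>)\<^sup>2)
        + 2 * expectation (\<lambda>\<omega>. work t \<omega> * (n * load - \<Sigma> t \<omega>)) + expectation (\<lambda>\<omega>. (\<Delta> t \<omega>)\<^sup>2)"
      using integrable_work_square cross_int \<Delta>_int by (simp flip: cross)
    finally have "expectation (\<lambda>\<omega>. (work (t + n) \<omega>)\<^sup>2) = expectation (\<lambda>\<omega>. (work t \<omega>)\<^sup>2)
        + 2 * expectation (\<lambda>\<omega>. work t \<omega> * (n * load - \<Sigma> t \<omega>)) + expectation (\<lambda>\<omega>. (\<Delta> t \<omega>)\<^sup>2)" .
    moreover have "expectation (\<lambda>\<omega>. work t \<omega> * (n * load - \<Sigma> t \<omega>)) \<le> expectation (\<lambda>\<omega>. M - work t \<omega>)"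
      using integrable_work by (intro integral_mono \<Sigma>_int pointwise) simp
    moreover have "expectation (\<lambda>\<omega>. M - work t \<omega>) = M - expectation (work t)"
      using integrable_work by (simp add: prob_space)
    moreover have "expectation (\<lambda>\<omega>. (\<Delta> t \<omega>)\<^sup>2) \<le> n * (n * (B + P\<^sup>2))"
      by (rule order_trans[OF integral_mono[OF \<Delta>_int E_int \<Delta>_le] E_le])
    ultimately show ?thesis by linarith
  qed
  then show ?thesis by (rule that)
qed

theorem stable: "stable D s\<^sub>0 q\<^sub>0 I \<pi>"
proof -
  obtain n C where drift: "\<And>t. expectation (\<lambda>\<omega>. (work (t + n) \<omega>)\<^sup>2) + 2 * expectation (work t)
      \<le> expectation (\<lambda>\<omega>. (work t \<omega>)\<^sup>2) + C"
    by (rule square_drift) blast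
  define V where "V t = expectation (\<lambda>\<omega>. (work t \<omega>)\<^sup>2)" for t
  have V: "0 \<le> V t" for t by (simp add: V_def)
  have "(\<Sum>t<T. expectation (work t)) \<le> C / 2 * T + (\<Sum>t<n. V t) / 2" for T
  proof -
    \<comment> \<open>The sum of \<open>V\<close> over \<open>t < T\<close> exceeds that over \<open>n \<le> t < T + n\<close> at most by that over \<open>t < n\<close>.\<close>
    have "(\<Sum>t<T. V (t + n) + 2 * expectation (work t)) \<le> (\<Sum>t<T. V t + C)"
      unfolding V_def by (intro sum_mono drift)
    then have "(\<Sum>t<T. V (t + n)) + 2 * (\<Sum>t<T. expectation (work t)) \<le> (\<Sum>t<T. V t) + C * T"
      by (simp add: sum.distrib sum_distrib_left mult.commute)
    moreover have "(\<Sum>t<T. V t) \<le> (\<Sum>t<T + n. V t)"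
      by (intro sum_mono2) (auto simp: V)
    moreover have "(\<Sum>t<T + n. V t) = (\<Sum>t<n. V t) + (\<Sum>t<T. V (t + n))"
      by (induction T) (simp_all add: add.commute)
    ultimately show ?thesis by simp
  qed
  then show ?thesis by (rule stable_if_work_bounded)
qed

end

section \<open>The stability region\<close>

lemma sum_divide_scaleR:
  fixes r :: "real ^ 'n::finite"
  shows "(\<Sum>i\<in>UNIV. (c *\<^sub>R r) $ i / p i) = c * (\<Sum>i\<in>UNIV. r $ i / p i)"
  by (simp add: sum_distrib_left)

text \<open>
  Vectors in the larger simplex are limits of shrunken copies of themselves, which lie in the smaller
  one.
\<close>

lemma closure_between_simplices:
  fixes R :: "(real ^ 'n::finite) set" and p :: "'n \<Rightarrow> real"
  assumes inner: "{r. (\<forall>i. 0 \<le> r $ i) \<and> (\<Sum>i\<in>UNIV. r $ i / p i) < 1} \<subseteq> R"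
    and outer: "R \<subseteq> {r. (\<forall>i. 0 \<le> r $ i) \<and> (\<Sum>i\<in>UNIV. r $ i / p i) \<le> 1}"
  shows "closure R = {r. (\<forall>i. 0 \<le> r $ i) \<and> (\<Sum>i\<in>UNIV. r $ i / p i) \<le> 1}"
proof
  show "closure R \<subseteq> {r. (\<forall>i. 0 \<le> r $ i) \<and> (\<Sum>i\<in>UNIV. r $ i / p i) \<le> 1}"
    unfolding divide_inverse
    by (intro closure_minimal outer[unfolded divide_inverse] closed_Collect_conj closed_Collect_all
        closed_Collect_le continuous_intros)
  show "{r. (\<forall>i. 0 \<le> r $ i) \<and> (\<Sum>i\<in>UNIV. r $ i / p i) \<le> 1} \<subseteq> closure R"
  proof safe
    fix r :: "real ^ 'n" assume r: "\<forall>i. 0 \<le> r $ i" "(\<Sum>i\<in>UNIV. r $ i / p i) \<le> 1"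
    let ?c = "\<lambda>m. 1 - inverse (real (Suc m))"
    have c: "0 \<le> ?c m" "?c m < 1" for m by (simp_all add: field_simps)
    have "?c m * (\<Sum>i\<in>UNIV. r $ i / p i) < 1" for m
      using mult_left_mono[OF r(2) c(1)[of m]] c(2)[of m] by (simp only: mult_1_right le_less_trans)
    then have "?c m *\<^sub>R r \<in> R" for m
      using r(1) c(1)[of m] by (intro set_mp[OF inner]) (simp only: mem_Collect_eq sum_divide_scaleR, simp)
    moreover have "(\<lambda>m. ?c m *\<^sub>R r) \<longlonglongrightarrow> (1 - 0) *\<^sub>R r"
      by (intro tendsto_intros LIMSEQ_inverse_real_of_nat)
    then have "(\<lambda>m. ?c m *\<^sub>R r) \<longlonglongrightarrow> r" by (simp only: diff_zero scaleR_one)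
    ultimately show "r \<in> closure R"
      unfolding closure_sequential by (intro exI[of _ "\<lambda>m. ?c m *\<^sub>R r"] conjI allI)
  qed
qed

text \<open>
  Enlarging a nonnegative vector with \<open>(\<Sum>i\<in>UNIV. r $ i / p i) = 1\<close> slightly leads out of \<open>R\<close> without
  leaving the orthant, so no such vector lies in the relative interior.
\<close>

lemma rates_inside_between_simplices:
  fixes R :: "(real ^ 'n::finite) set" and p :: "'n \<Rightarrow> real"
  assumes inner: "{r. (\<forall>i. 0 \<le> r $ i) \<and> (\<Sum>i\<in>UNIV. r $ i / p i) < 1} \<subseteq> R"
    and outer: "R \<subseteq> {r. (\<forall>i. 0 \<le> r $ i) \<and> (\<Sum>i\<in>UNIV. r $ i / p i) \<le> 1}"
  shows "rates_inside R = {r. (\<forall>i. 0 \<le> r $ i) \<and> (\<Sum>i\<in>UNIV. r $ i / p i) < 1}"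
proof
  let ?U = "{r :: real ^ 'n. \<forall>i. 0 \<le> r $ i}"
  have "open {r :: real ^ 'n. (\<Sum>i\<in>UNIV. r $ i / p i) < 1}"
    unfolding divide_inverse by (intro open_Collect_less continuous_intros)
  then have "openin (top_of_set ?U) (?U \<inter> {r. (\<Sum>i\<in>UNIV. r $ i / p i) < 1})"
    by (rule openin_open_Int)
  then have "?U \<inter> {r. (\<Sum>i\<in>UNIV. r $ i / p i) < 1} \<subseteq> rates_inside R"
    unfolding rates_inside_def using inner by (intro interior_of_maximal) auto
  then show "{r. (\<forall>i. 0 \<le> r $ i) \<and> (\<Sum>i\<in>UNIV. r $ i / p i) < 1} \<subseteq> rates_inside R" by auto
  show "rates_inside R \<subseteq> {r. (\<forall>i. 0 \<le> r $ i) \<and> (\<Sum>i\<in>UNIV. r $ i / p i) < 1}"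
  proof
    fix r assume "r \<in> rates_inside R"
    then obtain T where T: "open T" "r \<in> T" "r \<in> ?U" "?U \<inter> T \<subseteq> R"
      unfolding rates_inside_def interior_of_def openin_open by auto
    let ?c = "\<lambda>m. 1 + inverse (real (Suc m))"
    have "(\<lambda>m. ?c m *\<^sub>R r) \<longlonglongrightarrow> (1 + 0) *\<^sub>R r"
      by (intro tendsto_intros LIMSEQ_inverse_real_of_nat)
    then have "\<forall>\<^sub>F m in sequentially. ?c m *\<^sub>R r \<in> T"
      using T(1,2) by (intro topological_tendstoD) auto
    then obtain m where "?c m *\<^sub>R r \<in> T" by (auto dest: eventually_happens)
    moreover have "?c m *\<^sub>R r \<in> ?U" using T(3) by simp
    ultimately have "?c m *\<^sub>R r \<in> R" using T(4) by blast
    then have "?c m * (\<Sum>i\<in>UNIV. r $ i / p i) \<le> 1"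
      using outer sum_divide_scaleR[of "?c m" r p] by auto
    moreover have "1 < ?c m" by simp
    ultimately have "(\<Sum>i\<in>UNIV. r $ i / p i) < 1"
      by (smt (verit) mult_less_cancel_right1 mult_le_cancel_left1)
    with T(3) show "r \<in> {r. (\<forall>i. 0 \<le> r $ i) \<and> (\<Sum>i\<in>UNIV. r $ i / p i) < 1}" by simp
  qed
qed

lemma exhaustive_policy_channel_blind:
  "exhaustive_policy nx u (Obs q c l d # h) = exhaustive_policy nx u (Obs q c' l d # h)"
  by (simp add: exhaustive_policy_def)

lemma gated_policy_channel_blind:
  "gated_policy nx u (Obs q c l d # h) = gated_policy nx u (Obs q c' l d # h)"
  by (simp add: gated_policy_def Let_def)

theorem theorem6:
  fixes p :: "'n::finite \<Rightarrow> real"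
    and D :: "'n \<Rightarrow> 'n \<Rightarrow> nat"
    and nx :: "'n \<Rightarrow> 'n"
    and s\<^sub>0 :: 'n
    and q\<^sub>0 :: "'n \<Rightarrow> nat"
    and S :: "real ^ 'n \<Rightarrow> ('w, 'n) inputs"
  assumes "1 < CARD('n)"
    and "\<And>i. 0 < p i"
    and "\<And>i j. i \<noteq> j \<Longrightarrow> 1 \<le> D i j"
    and "cyclic_order nx"
    and "\<And>r. (\<forall>i. 0 \<le> r $ i) \<Longrightarrow> valid_inputs p r (S r)"
  shows "closure (stability_region D s\<^sub>0 q\<^sub>0 S)
           = {r. (\<forall>i. 0 \<le> r $ i) \<and> (\<Sum>i\<in>UNIV. r $ i / p i) \<le> 1} \<and>
         rates_inside (stability_region D s\<^sub>0 q\<^sub>0 S)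
           = {r. (\<forall>i. 0 \<le> r $ i) \<and> (\<Sum>i\<in>UNIV. r $ i / p i) < 1} \<and>
         throughput_optimal D s\<^sub>0 q\<^sub>0 S (exhaustive_policy nx) \<and>
         throughput_optimal D s\<^sub>0 q\<^sub>0 S (gated_policy nx)"
proof -
  let ?R = "stability_region D s\<^sub>0 q\<^sub>0 S"
  have inputs: "queueing_inputs p r (S r)" if "\<forall>i. 0 \<le> r $ i" for r
    using assms that by (simp add: queueing_inputs_def)
  have admissible: "admissible (exhaustive_policy nx)" "admissible (gated_policy nx)"
    by (simp_all add: admissible_def exhaustive_policy_def gated_policy_def)
  have stable: "stable D s\<^sub>0 q\<^sub>0 (S r) \<pi>"
    if r: "\<forall>i. 0 \<le> r $ i" "(\<Sum>i\<in>UNIV. r $ i / p i) < 1"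
      and \<pi>: "\<pi> = exhaustive_policy nx \<or> \<pi> = gated_policy nx" for r and \<pi> :: "'n policy"
  proof -
    interpret queueing_inputs p r "S r" by (rule inputs[OF r(1)])
    interpret clearing_queues p r "S r" D s\<^sub>0 q\<^sub>0 \<pi> nx
    proof
      show "admissible \<pi>" using \<pi> admissible by blast
      show "clearing_policy D nx s\<^sub>0 q\<^sub>0 (S r) \<pi>"
        using \<pi> exhaustive_policy_clearing gated_policy_clearing by blast
      show "\<pi> u (Obs q c l d # h) = \<pi> u (Obs q c' l d # h)" for u q c c' l d h
        using \<pi> by (elim disjE) (simp_all only: exhaustive_policy_channel_blind gated_policy_channel_blind[of nx u q c l d h c'])
      show "load < 1" using r(2) by (simp add: load_def)
      show "nx i \<noteq> i" for i by (rule cyclic_order_no_fixpoint[OF assms(4,1)])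
    qed (rule assms)
    show ?thesis by (rule stable)
  qed
  have inner: "{r. (\<forall>i. 0 \<le> r $ i) \<and> (\<Sum>i\<in>UNIV. r $ i / p i) < 1} \<subseteq> ?R"
    unfolding stability_region_def using stable admissible(1) by blast
  have outer: "?R \<subseteq> {r. (\<forall>i. 0 \<le> r $ i) \<and> (\<Sum>i\<in>UNIV. r $ i / p i) \<le> 1}"
  proof
    fix r assume "r \<in> ?R"
    then obtain \<pi> where r: "\<forall>i. 0 \<le> r $ i"
      and \<pi>: "admissible \<pi>" "stable D s\<^sub>0 q\<^sub>0 (S r) \<pi>"
      unfolding stability_region_def by blast
    interpret queueing_inputs p r "S r" by (rule inputs[OF r])
    interpret controlled_queues p r "S r" D s\<^sub>0 q\<^sub>0 \<pi> by unfold_locales (rule \<pi>(1))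
    show "r \<in> {r. (\<forall>i. 0 \<le> r $ i) \<and> (\<Sum>i\<in>UNIV. r $ i / p i) \<le> 1}"
      using r stable_imp_load_le_1[OF \<pi>(2)] by (simp add: load_def)
  qed
  note closure = closure_between_simplices[OF inner outer]
  note inside = rates_inside_between_simplices[OF inner outer]
  have "throughput_optimal D s\<^sub>0 q\<^sub>0 S \<pi>"
    if "\<pi> = exhaustive_policy nx \<or> \<pi> = gated_policy nx" for \<pi>
    using that admissible stable inside
    by (auto simp: throughput_optimal_def achieves_fraction_def)
  with closure inside show ?thesis by blast
qed

end
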